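(* Let $G$ be a connected graph of maximal degree at most $3$ which is isomorphic neither to $K_4$ nor to the graph $T$. Then each connected component of the neighborhood complex $\mathcal{N}(G)$ is either contractible or homotopy equivalent to a wedge sum of circles.
   Context: All graphs are finite and simple (no loops). The maximal degree of a graph is the maximum of the degrees of its vertices. $K_4$ is the complete graph on $4$ vertices. $T$ is the graph with vertex set $\{1,2,\dots,8\}$ and edge set $\{12, 13, 14, 27, 28, 47, 45, 35, 38, 56, 67, 68\}$ (where $ij$ denotes the edge $\{i,j\}$). The neighborhood complex $\mathcal{N}(G)$ of a graph $G$ is the (abstract) simplicial complex whose vertices are all non-isolated vertices of $G$ and whose simplices are those subsets of $V(G)$ which have a common neighbor in $G$. Topological statements about a simplicial complex refer to its geometric realization. *)

theory Defs
  imports "HOL-Analysis.Analysis" "Graph_Theory.Graph_Theory"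
begin

section \<open>Graphs\<close>

text \<open>
  A finite simple graph is a \<^locale>\<open>pair_graph\<close>: an undirected edge \<open>uv\<close> is the pair of
  opposite arcs \<open>(u,v)\<close>, \<open>(v,u)\<close>.  Hence the degree of \<open>v\<close> is its out-degree, and a digraph
  isomorphism between such objects is a graph isomorphism.
\<close>

definition undirected_graph :: "'a set \<Rightarrow> 'a rel \<Rightarrow> 'a pair_pre_digraph" where
  "undirected_graph V E = \<lparr> pverts = V, parcs = E \<union> E\<inverse> \<rparr>"

lemma pair_graph_undirected_graph:
  assumes "finite V" and E: "E \<subseteq> V \<times> V" and irr: "\<forall>e\<in>E. fst e \<noteq> snd e"
  shows "pair_graph (undirected_graph V E)"
proof -
  have "finite E"
    using assms finite_subset by blast
  moreover have "sym (E \<union> E\<inverse>)"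
    by (rule sym_Un_converse)
  ultimately show ?thesis
    using assms by unfold_locales (auto simp: undirected_graph_def symmetric_def)
qed

text \<open>Only meaningful if \<open>G\<close> has finitely many vertices, and at least one.\<close>

definition max_degree :: "'a pair_pre_digraph \<Rightarrow> nat" where
  "max_degree G = Max (out_degree (with_proj G) ` pverts G)"

definition K4_graph :: "nat pair_pre_digraph" where
  "K4_graph = undirected_graph {1..4} {(u, v). u \<in> {1..4} \<and> v \<in> {1..4} \<and> u \<noteq> v}"

definition T_graph :: "nat pair_pre_digraph" where
  "T_graph = undirected_graph {1..8}
     {(1,2), (1,3), (1,4), (2,7), (2,8), (4,7), (4,5), (3,5), (3,8), (5,6), (6,7), (6,8)}"

lemma K4_graph_complete: "complete_digraph 4 (with_proj K4_graph)"
proof -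
  have "parcs K4_graph = {(u, v). (u, v) \<in> pverts K4_graph \<times> pverts K4_graph \<and> u \<noteq> v}"
    unfolding K4_graph_def undirected_graph_def by force
  moreover have "pverts K4_graph = {1..4}"
    by (simp add: K4_graph_def undirected_graph_def)
  ultimately show ?thesis
    by (simp add: complete_digraph_pair_def)
qed

lemma pair_graph_T_graph: "pair_graph T_graph"
  unfolding T_graph_def by (rule pair_graph_undirected_graph) simp_all


section \<open>The neighborhood complex and geometric realization\<close>

text \<open>
  An abstract simplicial complex is given by its set of simplices; its vertices are the elements
  of its simplices.  The empty simplex is allowed, and has no effect on the realization.
\<close>

definition neighborhood_complex :: "'a pair_pre_digraph \<Rightarrow> 'a set set" where
  "neighborhood_complex G =
     {S. S \<subseteq> pverts G \<and> (\<exists>w \<in> pverts G. \<forall>v \<in> S. (v, w) \<in> parcs G)}"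

lemma (in pair_wf_digraph) vertices_neighborhood_complex:
  "\<Union> (neighborhood_complex G) = {v \<in> pverts G. \<exists>w. (v, w) \<in> parcs G}"
proof (intro equalityI subsetI)
  fix v
  assume "v \<in> \<Union> (neighborhood_complex G)"
  then show "v \<in> {v \<in> pverts G. \<exists>w. (v, w) \<in> parcs G}"
    unfolding neighborhood_complex_def by blast
next
  fix v
  assume "v \<in> {v \<in> pverts G. \<exists>w. (v, w) \<in> parcs G}"
  then obtain w where "v \<in> pverts G" "(v, w) \<in> parcs G"
    by blast
  moreover from this have "w \<in> pverts G"
    by (blast dest: in_arcsD2)
  ultimately have "{v} \<in> neighborhood_complex G"
    unfolding neighborhood_complex_def by blast
  then show "v \<in> \<Union> (neighborhood_complex G)"
    by blast
qed

text \<open>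
  Points of the realization are given by their barycentric coordinates.  The topology of
  pointwise convergence is the usual (coherent) topology of the realization only if the complex
  is finite, so the definition is intended for finite complexes.
\<close>

definition geometric_realization :: "'a set set \<Rightarrow> ('a \<Rightarrow> real) topology" where
  "geometric_realization K = subtopology (powertop_real UNIV)
     {x. (\<forall>v. 0 \<le> x v) \<and> {v. x v \<noteq> 0} \<in> K \<and> (\<Sum>v | x v \<noteq> 0. x v) = 1}"


section \<open>Wedge sums\<close>

definition quotient_topology :: "'a topology \<Rightarrow> ('a \<Rightarrow> 'b) \<Rightarrow> 'b topology" where
  "quotient_topology X f =
     topology (\<lambda>U. U \<subseteq> f ` topspace X \<and> openin X {x \<in> topspace X. f x \<in> U})"

lemma openin_quotient_topology:
  "openin (quotient_topology X f) U \<longleftrightarrow>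
     U \<subseteq> f ` topspace X \<and> openin X {x \<in> topspace X. f x \<in> U}"
proof -
  have *: "{x \<in> topspace X. f x \<in> S \<inter> T} =
      {x \<in> topspace X. f x \<in> S} \<inter> {x \<in> topspace X. f x \<in> T}" for S T
    by auto
  have **: "{x \<in> topspace X. f x \<in> \<Union>\<K>} = (\<Union>S\<in>\<K>. {x \<in> topspace X. f x \<in> S})" for \<K>
    by auto
  have "istopology (\<lambda>U. U \<subseteq> f ` topspace X \<and> openin X {x \<in> topspace X. f x \<in> U})"
    unfolding istopology_def * ** by blast
  then show ?thesis
    by (simp add: quotient_topology_def)
qed

lemma topspace_quotient_topology [simp]:
  "topspace (quotient_topology X f) = f ` topspace X"
proof
  show "topspace (quotient_topology X f) \<subseteq> f ` topspace X"
    using openin_topspace [of "quotient_topology X f"]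
    unfolding openin_quotient_topology by (rule conjunct1)
  have "{x \<in> topspace X. f x \<in> f ` topspace X} = topspace X"
    by auto
  then have "openin (quotient_topology X f) (f ` topspace X)"
    by (simp add: openin_quotient_topology)
  then show "f ` topspace X \<subseteq> topspace (quotient_topology X f)"
    by (rule openin_subset)
qed

lemma quotient_map_quotient_topology: "quotient_map X (quotient_topology X f) f"
  by (simp add: quotient_map_def openin_quotient_topology)

text \<open>
  The disjoint union of the pointed spaces \<open>(X i, p i)\<close>, \<open>i \<in> I\<close>, with all base points
  identified to the single point \<^term>\<open>None\<close>.  The index set must be nonempty (for \<open>I = {}\<close>
  one gets the empty space instead of a point).
\<close>

definition wedge_sum :: "'i set \<Rightarrow> ('i \<Rightarrow> 'a topology) \<Rightarrow> ('i \<Rightarrow> 'a) \<Rightarrow> ('i \<times> 'a) option topology"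
  where "wedge_sum I X p =
    quotient_topology (sum_topology X I) (\<lambda>(i, x). if x = p i then None else Some (i, x))"

definition wedge_of_circles :: "nat \<Rightarrow> (nat \<times> complex) option topology" where
  "wedge_of_circles n = wedge_sum {..<n} (\<lambda>_. top_of_set (sphere 0 1)) (\<lambda>_. 1)"

end

theory Submission
  imports Defs
begin

text \<open>
  In \<open>N(G)\<close> every simplex has at most three vertices, and every vertex lies in at most three
  facets \<open>N(w)\<close>.  Replace a component, up to homotopy equivalence, by a minimal subcomplex obtained
  by elementary collapses.  If a triangle survives, each edge of it lies in a second triangle, and the
  bound on the facets around a vertex forces these triangles to be the boundary of a tetrahedron, all of
  whose vertices have their three neighborhoods used up.  By connectedness, \<open>G\<close> is then \<open>K\<^sub>4\<close> or
  the cube \<open>T\<close>.  Otherwise a connected graph remains.  A maximal contractible subcomplex of it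
  contains all vertices, and contracting that subcomplex leaves one circle for each remaining edge.
\<close>

section \<open>Simplicial complexes and collapses\<close>

text \<open>The exceptions are genuine: the neighborhood complex of \<open>K4_graph\<close> is the
  boundary of a tetrahedron, that of the cube consists of two such boundaries, and these are
  spheres. Both graphs come from one pattern: a set X of four vertices and a set W of four vertices
  whose neighborhoods are the four 3-subsets of X. Adjacency carries X into W and W into X, so X and
  W either coincide, giving the complete graph, or are disjoint, giving the complete bipartite graph
  on 4 + 4 vertices minus a perfect matching, which is the cube.

  Collapses of triangles are not performed in sequence. A subcomplex with fewest simplices is chosen
  among the connected ones homotopy equivalent to the component, and a free edge of a triangle would
  contradict this choice.

  For graphs, the extension of a contraction of the subcomplex to the whole space is written down
  explicitly on each arc instead of being drawn from a general homotopy extension property.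
  Compactness of finite complexes and separation of the wedge turn the continuous surjections
  involved into quotient maps.\<close>

definition polyhedron :: "'a set set \<Rightarrow> ('a \<Rightarrow> real) set" where
  "polyhedron K = {x. (\<forall>v. 0 \<le> x v) \<and> {v. x v \<noteq> 0} \<in> K \<and> (\<Sum>v | x v \<noteq> 0. x v) = 1}"

text \<open>The clause \<open>\<tau> \<noteq> {}\<close> leaves it open whether the empty simplex
  belongs to \<open>K\<close>: a neighborhood complex may contain it, a one-vertex complex
  \<open>{{v}}\<close> does not. No point has empty support, because coordinates sum to 1.\<close>

definition simplicial_complex :: "'a set set \<Rightarrow> bool" where
  "simplicial_complex K \<longleftrightarrow>
     finite K \<and> (\<forall>\<sigma>\<in>K. finite \<sigma>) \<and> (\<forall>\<sigma>\<in>K. \<forall>\<tau>. \<tau> \<subseteq> \<sigma> \<longrightarrow> \<tau> \<noteq> {} \<longrightarrow> \<tau> \<in> K)"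

lemma simplicial_complexD:
  assumes "simplicial_complex K"
  shows "finite K" "\<sigma> \<in> K \<Longrightarrow> finite \<sigma>"
    "\<sigma> \<in> K \<Longrightarrow> \<tau> \<subseteq> \<sigma> \<Longrightarrow> \<tau> \<noteq> {} \<Longrightarrow> \<tau> \<in> K"
  using assms by (auto simp: simplicial_complex_def)

lemma geometric_realization_polyhedron:
  "geometric_realization K = subtopology (powertop_real UNIV) (polyhedron K)"
  by (simp add: geometric_realization_def polyhedron_def)

lemma topspace_geometric_realization [simp]:
  "topspace (geometric_realization K) = polyhedron K"
  by (simp add: geometric_realization_polyhedron)

lemma continuous_map_into_geometric_realization:
  "continuous_map Z (geometric_realization K) f \<longleftrightarrow>
     (\<forall>v. continuous_map Z euclideanreal (\<lambda>z. f z v)) \<and> f \<in> topspace Z \<rightarrow> polyhedron K"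
  by (simp add: geometric_realization_polyhedron continuous_map_in_subtopology
      continuous_map_componentwise_UNIV image_subset_iff_funcset)

lemma continuous_map_coordinate [continuous_intros]:
  "continuous_map Z (geometric_realization K) f \<Longrightarrow> continuous_map Z euclideanreal (\<lambda>z. f z v)"
  by (simp add: continuous_map_into_geometric_realization)

text \<open>Points are functions on the whole vertex type, so all realizations lie in one ambient
  space and a subcomplex gives a subspace literally, not merely up to homeomorphism.\<close>

lemma geometric_realization_mono:
  "L \<subseteq> K \<Longrightarrow> geometric_realization L = subtopology (geometric_realization K) (polyhedron L)"
  by (auto simp: geometric_realization_polyhedron subtopology_subtopology polyhedron_def
      intro!: arg_cong2[where f = subtopology])

text \<open>The support varies with the point; summation over a fixed finite set is linear and
  continuous in \<open>x\<close>.\<close>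

lemma sum_polyhedron:
  assumes "x \<in> polyhedron K" "{v. x v \<noteq> 0} \<subseteq> S" "finite S"
  shows "sum x S = 1"
proof -
  have "sum x S = (\<Sum>v | x v \<noteq> 0. x v)"
    using assms by (intro sum.mono_neutral_right) auto
  then show ?thesis
    using assms by (simp add: polyhedron_def)
qed

lemma polyhedronI:
  assumes "\<And>v. 0 \<le> x v" "{v. x v \<noteq> 0} \<in> K" "{v. x v \<noteq> 0} \<subseteq> S" "finite S" "sum x S = 1"
  shows "x \<in> polyhedron K"
proof -
  have "sum x S = (\<Sum>v | x v \<noteq> 0. x v)"
    using assms by (intro sum.mono_neutral_right) auto
  then show ?thesis
    using assms by (simp add: polyhedron_def)
qed

lemma support_nonempty: "x \<in> polyhedron K \<Longrightarrow> {v. x v \<noteq> 0} \<noteq> {}"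
proof
  assume "x \<in> polyhedron K" "{v. x v \<noteq> 0} = {}"
  then show False
    using sum_polyhedron[of x K "{}"] by simp
qed

lemma support_in_complex: "x \<in> polyhedron K \<Longrightarrow> {v. x v \<noteq> 0} \<in> K"
  by (simp add: polyhedron_def)

lemma simplicial_complex_Pow: "finite \<sigma> \<Longrightarrow> simplicial_complex (Pow \<sigma>)"
  by (auto simp: simplicial_complex_def intro: finite_subset)

lemma continuous_map_Min:
  fixes f :: "'b \<Rightarrow> 'a \<Rightarrow> real"
  assumes "finite S" "S \<noteq> {}" "\<And>u. u \<in> S \<Longrightarrow> continuous_map X euclideanreal (\<lambda>z. f z u)"
  shows "continuous_map X euclideanreal (\<lambda>z. Min (f z ` S))"
  using assms
proof (induction S rule: finite_ne_induct)
  case (insert u F)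
  then show ?case
    by (simp add: continuous_map_real_min)
qed simp

text \<open>Pushing along \<open>v\<close> minus the barycenter of \<open>\<tau>\<close> until some coordinate in \<open>\<tau>\<close> vanishes moves
  only points of the two removed open simplices, and is continuous on the whole polyhedron.\<close>

lemma elementary_collapse:
  assumes K: "simplicial_complex K" and \<sigma>: "\<sigma> \<in> K" "v \<in> \<sigma>" and \<tau>: "\<tau> = \<sigma> - {v}" "\<tau> \<noteq> {}"
    and free: "\<And>\<rho>. \<rho> \<in> K \<Longrightarrow> \<tau> \<subseteq> \<rho> \<Longrightarrow> \<rho> = \<tau> \<or> \<rho> = \<sigma>"
  obtains r where
    "homotopic_with (\<lambda>_. True) (geometric_realization K) (geometric_realization K) (id \<circ> r) id"
    "retraction_maps (geometric_realization K) (geometric_realization (K - {\<sigma>, \<tau>})) r id"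
proof -
  define m where "m = (\<lambda>x :: 'a \<Rightarrow> real. Min (x ` \<tau>))"
  \<comment> \<open>Each coordinate in \<open>\<tau>\<close> loses \<open>t * m x\<close> and
    \<open>v\<close> gains the total, so the coordinate sum is preserved. At \<open>t = 1\<close> a
    smallest coordinate in \<open>\<tau>\<close> reaches 0.\<close>
  define h where "h = (\<lambda>(t, x) u. x u - t * m x * (if u \<in> \<tau> then 1 else 0)
      + t * m x * card \<tau> * (if u = v then 1 else 0 :: real))"
  have fin: "finite \<sigma>" "finite \<tau>"
    using simplicial_complexD[OF K] \<sigma> \<tau> by auto
  have v: "v \<notin> \<tau>"
    using \<tau> by simp
  have m_le: "m x \<le> x u" if "u \<in> \<tau>" for x u
    using that fin by (simp add: m_def)
  have m_att: "\<exists>u\<in>\<tau>. m x = x u" for x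
  proof -
    have "m x \<in> x ` \<tau>"
      unfolding m_def using fin \<tau>(2) by (intro Min_in) auto
    then show ?thesis
      by auto
  qed
  have m0: "0 \<le> m x" if "x \<in> polyhedron K" for x
    using m_att[of x] that by (auto simp: polyhedron_def)
  \<comment> \<open>A positive minimum puts \<open>\<tau>\<close> inside the support, and freeness
    leaves only the supports \<open>\<tau>\<close> and \<open>\<sigma>\<close>. At all other points
    \<open>m\<close> vanishes, so that one formula serves the whole polyhedron.\<close>
  have m_pos: "{u. x u \<noteq> 0} \<in> {\<sigma>, \<tau>}" if "x \<in> polyhedron K" "m x \<noteq> 0" for x
  proof -
    have "\<tau> \<subseteq> {u. x u \<noteq> 0}"
      using m_le[of _ x] m0[OF that(1)] that(2) by fastforce
    then show ?thesis
      using free[OF support_in_complex[OF that(1)]] by auto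
  qed
  have h_nonneg: "0 \<le> h (t, x) u" if "x \<in> polyhedron K" "t \<in> {0..1}" for t x u
  proof -
    have "t * m x \<le> x u" if "u \<in> \<tau>"
      using m_le[OF that, of x] m0[OF \<open>x \<in> polyhedron K\<close>] \<open>t \<in> {0..1}\<close>
        mult_right_mono[of t 1 "m x"] by auto
    moreover have "0 \<le> x u"
      using that by (simp add: polyhedron_def)
    ultimately show ?thesis
      using m0[OF that(1)] that(2) by (auto simp: h_def)
  qed
  have h_sum: "sum (h (t, x)) \<sigma> = sum x \<sigma>" for t x
  proof -
    have "\<sigma> \<inter> \<tau> = \<tau>" "\<sigma> \<inter> {v} = {v}"
      using \<tau> \<sigma> by auto
    then have *: "(\<Sum>u\<in>\<sigma>. if u \<in> \<tau> then 1 else 0 :: real) = card \<tau>"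
      "(\<Sum>u\<in>\<sigma>. if u = v then 1 else 0 :: real) = 1"
      using fin \<sigma> by (simp_all add: sum.If_cases)
    show ?thesis
      unfolding h_def by (simp add: sum.distrib sum_subtractf * flip: sum_distrib_left)
  qed
  have h_id: "h (t, x) = x" if "m x = 0" for t x
    using that by (simp add: h_def)
  have h_supp: "{u. h (t, x) u \<noteq> 0} \<subseteq> \<sigma>" if "x \<in> polyhedron K" "m x \<noteq> 0" for t x
    using m_pos[OF that] \<sigma> \<tau> by (auto simp: h_def split: if_splits)
  have h_in: "h (t, x) \<in> polyhedron K" if x: "x \<in> polyhedron K" "t \<in> {0..1}" for t x
  proof (cases "m x = 0")
    case False
    have s1: "sum (h (t, x)) \<sigma> = 1"
      unfolding h_sum using m_pos[OF x(1) False] \<tau> fin by (intro sum_polyhedron[OF x(1)]) auto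
    then have "{u. h (t, x) u \<noteq> 0} \<noteq> {}"
      by (metis (mono_tags, lifting) empty_Collect_eq sum.neutral zero_neq_one)
    then show ?thesis
      using h_supp[OF x(1) False] s1 h_nonneg[OF x] fin simplicial_complexD(3)[OF K \<sigma>(1)]
      by (intro polyhedronI[where S = \<sigma>]) auto
  qed (use h_id x in simp)
  have h1: "h (1, x) \<in> polyhedron (K - {\<sigma>, \<tau>})" if x: "x \<in> polyhedron K" for x
  proof -
    obtain u where u: "u \<in> \<tau>" "m x = x u"
      using m_att by blast
    then have "h (1, x) u = 0"
      using v by (auto simp: h_def)
    then have "{u. h (1, x) u \<noteq> 0} \<notin> {\<sigma>, \<tau>}"
      using u \<tau> by auto
    then show ?thesis
      using h_in[OF x, of 1] by (simp add: polyhedron_def)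
  qed
  have h_fix: "h (t, x) = x" if "x \<in> polyhedron (K - {\<sigma>, \<tau>})" for t x
    using that m_pos[of x] h_id[of x] by (auto simp: polyhedron_def)
  let ?X = "geometric_realization K" and ?Y = "geometric_realization (K - {\<sigma>, \<tau>})"
  have cm: "continuous_map (prod_topology (top_of_set {0..1}) ?X) euclideanreal
      (\<lambda>z. m (snd z))"
    unfolding m_def using fin(2) \<tau>(2)
    by (intro continuous_map_Min continuous_map_coordinate[OF continuous_map_snd])
  have ct: "continuous_map (prod_topology (top_of_set {0..1}) ?X) euclideanreal fst"
    using continuous_map_fst continuous_map_into_fulltopology by blast
  have ch: "continuous_map (prod_topology (top_of_set {0..1}) ?X) ?X h"
    unfolding continuous_map_into_geometric_realization
  proof (intro conjI allI)
    show "continuous_map (prod_topology (top_of_set {0..1}) ?X) euclideanreal (\<lambda>z. h z u)" for u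
      unfolding h_def case_prod_unfold
      by (intro continuous_map_add continuous_map_diff continuous_map_real_mult ct cm
          continuous_map_coordinate[OF continuous_map_snd]) auto
  qed (use h_in in auto)
  define r where "r = (\<lambda>x. h (1, x))"
  have r: "continuous_map ?X ?X r"
    unfolding r_def
    using continuous_map_compose[OF _ ch, of ?X "\<lambda>x. (1, x)"]
    by (simp add: o_def continuous_map_pairwise)
  have "retraction_maps ?X ?Y r id"
    unfolding retraction_maps_def
  proof (intro conjI)
    show "continuous_map ?X ?Y r"
      using r h1 by (auto simp: geometric_realization_mono[of "K - {\<sigma>, \<tau>}" K]
          continuous_map_in_subtopology r_def)
    show "continuous_map ?Y ?X id"
      by (auto simp: geometric_realization_mono[of "K - {\<sigma>, \<tau>}" K] continuous_map_from_subtopology)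
    show "\<forall>x\<in>topspace ?Y. r (id x) = x"
      using h_fix by (simp add: r_def)
  qed
  moreover have "homotopic_with (\<lambda>_. True) ?X ?X id (id \<circ> r)"
    unfolding homotopic_with_def
    by (rule exI[of _ h]) (use ch in \<open>auto simp: r_def h_def\<close>)
  ultimately show ?thesis
    using that homotopic_with_sym by blast
qed

section \<open>Connected components as realizations of subcomplexes\<close>

text \<open>The straight segment from \<open>x\<close> to \<open>y\<close> stays in the realization:
  its supports lie in \<open>\<sigma>\<close> and are nonempty because the coordinates sum to
  1.\<close>

lemma connected_component_of_simplex:
  assumes K: "simplicial_complex K" and \<sigma>: "\<sigma> \<in> K"
    and x: "x \<in> polyhedron (Pow \<sigma>)" and y: "y \<in> polyhedron (Pow \<sigma>)"
  shows "connected_component_of (geometric_realization K) x y"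
proof -
  let ?g = "\<lambda>(t::real) u. (1 - t) * x u + t * y u"
  have "finite \<sigma>"
    using simplicial_complexD[OF K] \<sigma> by auto
  have "?g t \<in> polyhedron K" if t: "t \<in> {0..1}" for t
  proof -
    have sum: "sum (?g t) \<sigma> = 1"
      using sum_polyhedron[OF x _ \<open>finite \<sigma>\<close>] sum_polyhedron[OF y _ \<open>finite \<sigma>\<close>] x y
      by (simp add: sum.distrib polyhedron_def flip: sum_distrib_left)
    have "x u = 0" "y u = 0" if "u \<notin> \<sigma>" for u
      using x y that by (auto simp: polyhedron_def)
    then have sub: "{u. ?g t u \<noteq> 0} \<subseteq> \<sigma>"
      by force
    have "{u. ?g t u \<noteq> 0} \<noteq> {}"
    proof
      assume "{u. ?g t u \<noteq> 0} = {}"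
      then have "?g t = (\<lambda>u. 0)"
        by auto
      then show False
        using sum by (metis sum.neutral_const zero_neq_one)
    qed
    then show ?thesis
      using sub sum \<open>finite \<sigma>\<close> simplicial_complexD(3)[OF K \<sigma>] x y t
      by (intro polyhedronI[where S = \<sigma>]) (auto simp: polyhedron_def)
  qed
  then have "continuous_map (top_of_set {0..1}) (geometric_realization K) ?g"
    unfolding continuous_map_into_geometric_realization
    by (auto intro!: continuous_intros)
  then have "connectedin (geometric_realization K) (?g ` {0..1})"
    by (rule connectedin_continuous_map_image) (simp add: connectedin_subtopology)
  moreover have "x \<in> ?g ` {0..1}" "y \<in> ?g ` {0..1}"
    by (rule image_eqI[of _ _ 0], auto, rule image_eqI[of _ _ 1], auto)
  ultimately show ?thesis
    unfolding connected_component_of_def by blast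
qed

text \<open>\<open>polyhedron {\<tau>}\<close> is the open simplex of \<open>\<tau>\<close>; the
  witness is its barycenter.\<close>

lemma polyhedron_singleton_nonempty:
  assumes "finite \<tau>" "\<tau> \<noteq> {}"
  obtains y where "y \<in> polyhedron {\<tau>}"
proof
  show "(\<lambda>u. if u \<in> \<tau> then 1 / card \<tau> else 0) \<in> polyhedron {\<tau>}"
    using assms by (intro polyhedronI[where S = \<tau>]) auto
qed

lemma polyhedron_mono: "L \<subseteq> K \<Longrightarrow> polyhedron L \<subseteq> polyhedron K"
  by (auto simp: polyhedron_def)

text \<open>Closed simplices are connected, so \<open>C\<close> contains each closed simplex that it
  meets. Hence the simplices whose open simplex meets \<open>C\<close> are closed under passing to
  nonempty faces and fill exactly \<open>C\<close>.\<close>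

lemma component_subcomplex:
  assumes K: "simplicial_complex K" and C: "C \<in> connected_components_of (geometric_realization K)"
  obtains L where "L \<subseteq> K" "simplicial_complex L" "polyhedron L = C" "connected_space (geometric_realization L)"
    "subtopology (geometric_realization K) C = geometric_realization L"
proof -
  define L where "L = {\<sigma> \<in> K. \<sigma> \<noteq> {} \<and> polyhedron {\<sigma>} \<inter> C \<noteq> {}}"
  have sub: "L \<subseteq> K"
    by (auto simp: L_def)
  have CX: "C \<subseteq> polyhedron K"
    using connected_components_of_subset[OF C] by simp
  have closed: "y \<in> C" if "x \<in> C" "\<sigma> \<in> K" "x \<in> polyhedron (Pow \<sigma>)" "y \<in> polyhedron (Pow \<sigma>)" for x y \<sigma>
  proof -
    obtain z where z: "C = connected_component_of_set (geometric_realization K) z"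
      using C by (auto simp: connected_components_of_def)
    then show ?thesis
      using connected_component_of_simplex[OF K that(2-4)] that(1) connected_component_of_trans
      by fastforce
  qed
  have Pow: "polyhedron {\<sigma>} \<subseteq> polyhedron (Pow \<sigma>)" for \<sigma> :: "'a set"
    by (auto intro!: polyhedron_mono)
  have L: "simplicial_complex L"
    unfolding simplicial_complex_def
  proof (intro conjI ballI allI impI)
    show "finite L" "\<And>\<sigma>. \<sigma> \<in> L \<Longrightarrow> finite \<sigma>"
      using sub simplicial_complexD[OF K] finite_subset by auto
    fix \<sigma> \<tau>
    assume \<sigma>: "\<sigma> \<in> L" "\<tau> \<subseteq> \<sigma>" "\<tau> \<noteq> {}"
    then have \<tau>: "\<tau> \<in> K" "finite \<tau>"
      using simplicial_complexD[OF K] sub by blast+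
    obtain y where y: "y \<in> polyhedron {\<tau>}"
      using polyhedron_singleton_nonempty \<tau> \<sigma> by blast
    obtain x where x: "x \<in> polyhedron {\<sigma>}" "x \<in> C"
      using \<sigma> by (auto simp: L_def)
    have "y \<in> polyhedron (Pow \<sigma>)"
      using y \<sigma>(2) by (auto simp: polyhedron_def)
    then have "y \<in> C"
      using closed[OF x(2), of \<sigma>] x Pow sub \<sigma> by blast
    then show "\<tau> \<in> L"
      using y \<tau> \<sigma> by (auto simp: L_def)
  qed
  have eq: "polyhedron L = C"
  proof
    show "polyhedron L \<subseteq> C"
    proof
      fix x
      assume x: "x \<in> polyhedron L"
      define \<sigma> where "\<sigma> = {v. x v \<noteq> 0}"
      have "\<sigma> \<in> L"
        using support_in_complex[OF x] by (simp add: \<sigma>_def)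
      then obtain y where y: "y \<in> polyhedron {\<sigma>}" "y \<in> C"
        by (auto simp: L_def)
      have "x \<in> polyhedron {\<sigma>}"
        using x by (auto simp: polyhedron_def \<sigma>_def)
      then show "x \<in> C"
        using closed[OF y(2)] y Pow sub \<open>\<sigma> \<in> L\<close> by blast
    qed
    show "C \<subseteq> polyhedron L"
    proof
      fix x
      assume x: "x \<in> C"
      then have xK: "x \<in> polyhedron K"
        using CX by auto
      then have "x \<in> polyhedron {{v. x v \<noteq> 0}}"
        by (simp add: polyhedron_def)
      then have "{v. x v \<noteq> 0} \<in> L"
        using support_nonempty[OF xK] support_in_complex[OF xK] x by (auto simp: L_def)
      then show "x \<in> polyhedron L"
        using xK by (simp add: polyhedron_def)
    qed
  qed
  have top: "subtopology (geometric_realization K) C = geometric_realization L"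
    using geometric_realization_mono[OF sub] eq by simp
  have "connected_space (geometric_realization L)"
    using connectedin_connected_components_of[OF C] top by (metis connectedin_def)
  then show ?thesis
    using that sub L eq top by blast
qed

section \<open>Contracting subspaces and wedges of circles\<close>

text \<open>This is the argument showing \<open>X \<simeq> X/A\<close> when a contraction of \<open>A\<close> in itself extends to a
  homotopy of \<open>X\<close>: the end of the homotopy factors through the quotient.\<close>

lemma quotient_homotopy_equivalent:
  assumes X: "compact_space X" and Y: "Hausdorff_space Y"
    and q: "continuous_map X Y q" "q ` topspace X = topspace Y"
    and H: "continuous_map (prod_topology (top_of_set {0..1}) X) X H"
    and H0: "\<And>x. x \<in> topspace X \<Longrightarrow> H (0::real, x) = x"
    and H1: "\<And>x y. x \<in> topspace X \<Longrightarrow> y \<in> topspace X \<Longrightarrow> q x = q y \<Longrightarrow> H (1, x) = H (1, y)"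
    and Hq: "\<And>x y t. x \<in> topspace X \<Longrightarrow> y \<in> topspace X \<Longrightarrow> q x = q y \<Longrightarrow> t \<in> {0..1} \<Longrightarrow>
      q (H (t, x)) = q (H (t, y))"
  shows "X homotopy_equivalent_space Y"
proof -
  let ?I = "top_of_set {0..1::real}"
  have "continuous_map X X (\<lambda>x. H (1, x))"
    using continuous_map_compose[OF _ H, of X "\<lambda>x. (1, x)"]
    by (simp add: o_def continuous_map_pairwise)
  \<comment> \<open>\<open>H\<close> at time 1 is constant on the fibres of \<open>q\<close>, so it
    descends to a map \<open>g\<close>, the homotopy inverse.\<close>
  then obtain g where g: "continuous_map Y X g" "\<And>x. x \<in> topspace X \<Longrightarrow> g (q x) = H (1, x)"
    using quotient_map_lift_exists[OF continuous_imp_quotient_map[OF q(1) X Y q(2)]] H1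
    by (metis (no_types, lifting))
  let ?Q = "\<lambda>(t, x). (t, q x)"
  \<comment> \<open>A continuous surjection from a compact space to a Hausdorff space is a quotient
    map. This applies to the product with the interval just as to \<open>q\<close> itself.\<close>
  have Q: "quotient_map (prod_topology ?I X) (prod_topology ?I Y) ?Q"
  proof (rule continuous_imp_quotient_map)
    show "continuous_map (prod_topology ?I X) (prod_topology ?I Y) ?Q"
      using continuous_map_compose[OF continuous_map_snd q(1), of ?I]
      by (simp add: continuous_map_pairwise o_def case_prod_unfold continuous_map_fst)
    show "compact_space (prod_topology ?I X)"
      using X by (simp add: compact_space_prod_topology compact_space_subtopology)
    show "Hausdorff_space (prod_topology ?I Y)"
      using Y by (simp add: Hausdorff_space_prod_topology Hausdorff_space_subtopology)
    show "?Q ` topspace (prod_topology ?I X) = topspace (prod_topology ?I Y)"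
      using q(2) by (force simp: image_iff)
  qed
  have *: "(q \<circ> H) z = (q \<circ> H) z'" if zz: "z \<in> topspace (prod_topology ?I X)"
    "z' \<in> topspace (prod_topology ?I X)" "?Q z = ?Q z'" for z z'
  proof -
    obtain t x x' where z: "z = (t, x)" "z' = (t, x')" "q x = q x'"
      using zz(3) by (cases z, cases z') auto
    then have "t \<in> {0..1}" "x \<in> topspace X" "x' \<in> topspace X"
      using zz by auto
    then show ?thesis
      using Hq[of x x' t] z by simp
  qed
  \<comment> \<open>\<open>q \<circ> H\<close> descends as well, to a homotopy from the identity of
    \<open>Y\<close> to \<open>q \<circ> g\<close>.\<close>
  obtain h where h: "continuous_map (prod_topology ?I Y) Y h"
    "\<And>z. z \<in> topspace (prod_topology ?I X) \<Longrightarrow> h (?Q z) = (q \<circ> H) z"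
    by (rule quotient_map_lift_exists[OF Q continuous_map_compose[OF H q(1)] *]) blast+
  have h': "h (t, q x) = q (H (t, x))" if "t \<in> {0..1}" "x \<in> topspace X" for t x
    using h(2)[of "(t, x)"] that by simp
  have "homotopic_with (\<lambda>_. True) X X id (g \<circ> q)"
    using H H0 g by (subst homotopic_with) auto
  moreover have "homotopic_with (\<lambda>_. True) Y Y id (q \<circ> g)"
  proof (subst homotopic_with)
    show "\<exists>h. continuous_map (prod_topology ?I Y) Y h \<and> (\<forall>x\<in>topspace Y. h (0, x) = id x) \<and>
        (\<forall>x\<in>topspace Y. h (1, x) = (q \<circ> g) x) \<and> (\<forall>t\<in>{0..1}. True)"
      using h(1) h'[of 0] h'[of 1] H0 g(2) by (intro exI[of _ h]) (auto simp flip: q(2))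
  qed simp
  ultimately show ?thesis
    unfolding homotopy_equivalent_space_def
    using q(1) g(1) by (intro exI[of _ q] exI[of _ g] conjI homotopic_with_symD[of _ _ _ id])
qed

section \<open>Separation and parametrization of the wedge of circles\<close>

lemma continuous_map_from_sum_topology:
  "continuous_map (sum_topology X I) Y f \<longleftrightarrow> (\<forall>i\<in>I. continuous_map (X i) Y (\<lambda>x. f (i, x)))"
proof
  assume "continuous_map (sum_topology X I) Y f"
  then show "\<forall>i\<in>I. continuous_map (X i) Y (\<lambda>x. f (i, x))"
    using continuous_map_compose[OF continuous_map_component_injection]
    by (fastforce simp: o_def)
next
  assume f: "\<forall>i\<in>I. continuous_map (X i) Y (\<lambda>x. f (i, x))"
  show "continuous_map (sum_topology X I) Y f"
    unfolding continuous_map_def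
  proof (intro conjI allI impI)
    show "f \<in> topspace (sum_topology X I) \<rightarrow> topspace Y"
      using f by (fastforce simp: continuous_map_def Pi_iff)
    fix U
    assume U: "openin Y U"
    have "openin (X i) {x \<in> topspace (X i). f (i, x) \<in> U}" if "i \<in> I" for i
      using f U that by (auto simp: continuous_map_def)
    then show "openin (sum_topology X I) {x \<in> topspace (sum_topology X I). f x \<in> U}"
      by (auto simp: openin_sum_topology)
  qed
qed

text \<open>The wedge maps injectively and continuously into a power of the complex plane: circle
  \<open>i\<close> goes to the \<open>i\<close>-th coordinate axis through the point with all
  coordinates 1. Hausdorffness pulls back along such a map.\<close>

lemma Hausdorff_wedge_of_circles: "Hausdorff_space (wedge_of_circles n)"
proof (rule Hausdorff_space_injective_preimage)
  let ?S = "sum_topology (\<lambda>_. top_of_set (sphere 0 1)) {..<n} :: (nat \<times> complex) topology"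
  let ?w = "\<lambda>(i, x). if x = (1::complex) then None else Some (i :: nat, x)"
  let ?j = "\<lambda>p k. case p of None \<Rightarrow> 1 | Some (i, x) \<Rightarrow> if k = i then x else (1::complex)"
  let ?P = "product_topology (\<lambda>_. euclidean) UNIV :: (nat \<Rightarrow> complex) topology"
  show "Hausdorff_space ?P"
    by (simp add: Hausdorff_space_product_topology)
  have w: "wedge_of_circles n = quotient_topology ?S ?w"
    by (simp add: wedge_of_circles_def wedge_sum_def)
  have "continuous_map ?S ?P (?j \<circ> ?w)"
    unfolding continuous_map_from_sum_topology continuous_map_componentwise_UNIV
  proof (intro ballI allI)
    fix i k
    have "(\<lambda>x. (?j \<circ> ?w) (i, x) k) = (if k = i then (\<lambda>x. x) else (\<lambda>x. 1))"
      by auto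
    then show "continuous_map (top_of_set (sphere 0 1)) euclidean (\<lambda>x. (?j \<circ> ?w) (i, x) k)"
      by auto
  qed
  then show "continuous_map (wedge_of_circles n) ?P ?j"
    unfolding w by (rule continuous_compose_quotient_map[OF quotient_map_quotient_topology])
  show "inj_on ?j (topspace (wedge_of_circles n))"
  proof (rule inj_onI)
    fix p p'
    assume "p \<in> topspace (wedge_of_circles n)" "p' \<in> topspace (wedge_of_circles n)" and eq: "?j p = ?j p'"
    then obtain z z' where z: "p = ?w z" "p' = ?w z'"
      unfolding w by auto
    have "?j p (fst z) = ?j p' (fst z)" "?j p (fst z') = ?j p' (fst z')"
      using eq by metis+
    then show "p = p'"
      unfolding z by (cases z; cases z') (auto split: if_splits)
  qed
qed

text \<open>The inclusion of the \<open>i\<close>-th circle into the wedge, with 1 as its base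
  point.\<close>

definition wedge_point :: "nat \<Rightarrow> complex \<Rightarrow> (nat \<times> complex) option" where
  "wedge_point i x = (if x = 1 then None else Some (i, x))"

lemma topspace_wedge_of_circles:
  "topspace (wedge_of_circles n) = (\<lambda>(i, x). wedge_point i x) ` ({..<n} \<times> sphere 0 1)"
  by (simp add: wedge_of_circles_def wedge_sum_def o_def wedge_point_def)

lemma continuous_map_wedge_point:
  assumes "i < n"
  shows "continuous_map (top_of_set (sphere 0 1)) (wedge_of_circles n) (wedge_point i)"
proof -
  let ?S = "sum_topology (\<lambda>_. top_of_set (sphere 0 1)) {..<n} :: (nat \<times> complex) topology"
  have "continuous_map ?S (wedge_of_circles n) (\<lambda>(i, x). wedge_point i x)"
    unfolding wedge_of_circles_def wedge_sum_def wedge_point_def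
    by (rule quotient_imp_continuous_map[OF quotient_map_quotient_topology])
  then show ?thesis
    using assms by (simp add: continuous_map_from_sum_topology)
qed

text \<open>\<open>Arg2pi\<close> recovers the angle on the open interval. The two ends are excluded
  because both are sent to 1.\<close>

lemma cis_two_pi_eq_iff:
  assumes "s \<in> {0<..<1}" "t \<in> {0<..<1}" "cis (2 * pi * s) = cis (2 * pi * t)"
  shows "s = t"
proof -
  have *: "Arg2pi (cis (2 * pi * u)) = 2 * pi * u" if "u \<in> {0<..<1}" for u
    using that by (intro Arg2pi_unique[of 1]) (auto simp: cis_conv_exp)
  have "2 * pi * s = 2 * pi * t"
    using *[OF assms(1)] *[OF assms(2)] assms(3) by metis
  then show ?thesis
    by simp
qed

lemma cis_two_pi_eq_1:
  assumes "s \<in> {0..1}" "cis (2 * pi * s) = 1"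
  shows "s \<in> {0, 1}"
proof (rule ccontr)
  assume "s \<notin> {0, 1}"
  then have s: "s \<in> {0<..<1}"
    using assms by auto
  have "Arg2pi (cis (2 * pi * s)) = 2 * pi * s"
    using s by (intro Arg2pi_unique[of 1]) (auto simp: cis_conv_exp)
  then show False
    using s assms(2) Arg2pi_of_real[of 1] by simp
qed

lemma cis_two_pi_surj:
  assumes "z \<in> sphere 0 1"
  obtains t where "t \<in> {0..1}" "cis (2 * pi * t) = z"
proof
  show "Arg2pi z / (2 * pi) \<in> {0..1}"
    using Arg2pi[of z] by auto
  show "cis (2 * pi * (Arg2pi z / (2 * pi))) = z"
    using Arg2pi_eq[of z] assms by (simp add: cis_conv_exp)
qed

text \<open>The homotopy contracts \<open>A\<close> and simultaneously drags each arc along the tracks of its end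
  points: at time \<open>t\<close> the arc becomes the part over \<open>[-t, 1 + t]\<close> of the path \<open>P i\<close>, which
  prolongs the arc by these two tracks.\<close>

lemma contractible_with_arcs_homotopy_equivalent_wedge_of_circles:
  fixes X :: "'a topology" and E :: "nat \<Rightarrow> 'a set" and s :: "nat \<Rightarrow> 'a \<Rightarrow> real"
    and e :: "nat \<Rightarrow> real \<Rightarrow> 'a"
  assumes X: "compact_space X" and A: "closedin X A" "contractible_space (subtopology X A)" "A \<noteq> {}"
    and n: "n \<ge> 1"
    and cover: "topspace X = A \<union> (\<Union>i<n. E i)"
    and clE: "\<And>i. i < n \<Longrightarrow> closedin X (E i)"
    and cs: "\<And>i. i < n \<Longrightarrow> continuous_map (subtopology X (E i)) euclideanreal (s i)"
    and ce: "\<And>i. i < n \<Longrightarrow> continuous_map (top_of_set {0..1}) X (e i)"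
    and s01: "\<And>i x. i < n \<Longrightarrow> x \<in> E i \<Longrightarrow> s i x \<in> {0..1}"
    and es: "\<And>i x. i < n \<Longrightarrow> x \<in> E i \<Longrightarrow> e i (s i x) = x"
    and se: "\<And>i t. i < n \<Longrightarrow> t \<in> {0..1} \<Longrightarrow> e i t \<in> E i \<and> s i (e i t) = t"
    and ends: "\<And>i. i < n \<Longrightarrow> e i 0 \<in> A \<and> e i 1 \<in> A"
    and int: "\<And>i x. i < n \<Longrightarrow> x \<in> E i \<Longrightarrow> x \<in> A \<Longrightarrow> s i x \<in> {0, 1}"
    and disj: "\<And>i j. i < n \<Longrightarrow> j < n \<Longrightarrow> i \<noteq> j \<Longrightarrow> E i \<inter> E j \<subseteq> A"
  shows "X homotopy_equivalent_space wedge_of_circles n"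
proof -
  let ?I = "top_of_set {0..1::real}" and ?W = "wedge_of_circles n"
  \<comment> \<open>Closed pieces for pasting: the arcs have the indices below \<open>n\<close>, and
    \<open>A\<close> takes the index \<open>n\<close>. Distinct pieces meet only inside
    \<open>A\<close>.\<close>
  define T where "T = (\<lambda>i. if i < n then E i else A)"
  have T_closed: "closedin X (T i)" for i
    using clE A by (simp add: T_def)
  have T_cover: "topspace X \<subseteq> \<Union> (T ` {..n})"
    by (force simp: T_def cover split: if_splits)
  have A_sub: "A \<subseteq> topspace X"
    using cover by blast
  have T_Int: "x \<in> A" if "x \<in> T i" "x \<in> T j" "i \<noteq> j" "i \<le> n" "j \<le> n" for x i j
    using that disj[of i j] by (auto simp: T_def split: if_splits)

  \<comment> \<open>Arc \<open>i\<close> is wrapped once around circle \<open>i\<close>. Its points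
    in \<open>A\<close> have parameter 0 or 1, hence go to the base point, in agreement with the
    value \<open>None\<close> on \<open>A\<close>.\<close>
  define fq where "fq = (\<lambda>i x. if i < n then wedge_point i (cis (2 * pi * s i x)) else None)"
  have fq_A: "fq i x = None" if "x \<in> T i" "x \<in> A" for i x
    using int[of i x] that by (auto simp: fq_def T_def wedge_point_def)
  have fq_cont: "continuous_map (subtopology X (T i)) ?W (fq i)" for i
  proof (cases "i < n")
    case True
    have "continuous_map euclideanreal (top_of_set (sphere 0 1)) (\<lambda>t. cis (2 * pi * t))"
      by (auto simp: continuous_map_in_subtopology intro!: continuous_intros)
    from continuous_map_compose[OF continuous_map_compose[OF cs[OF True] this]
        continuous_map_wedge_point[OF True]]
    show ?thesis
      using True by (simp add: T_def fq_def o_def)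
  next
    case False
    have "None = (\<lambda>(i, x). wedge_point i x) (0, 1)" "(0, 1) \<in> {..<n} \<times> sphere (0 :: complex) 1"
      using n by (auto simp: wedge_point_def)
    then have "None \<in> topspace ?W"
      unfolding topspace_wedge_of_circles by (rule image_eqI)
    then show ?thesis
      using False by (simp add: fq_def)
  qed
  obtain q where q: "continuous_map X ?W q"
    and q_fq: "\<And>x i. i \<in> {..n} \<Longrightarrow> x \<in> topspace X \<inter> T i \<Longrightarrow> q x = fq i x"
  proof (rule pasting_lemma_exists_closed[of "{..n}" X T ?W fq])
    show "fq i x = fq j x" if "i \<in> {..n}" "j \<in> {..n}" "x \<in> topspace X \<inter> T i \<inter> T j" for i j x
    proof (cases "i = j")
      case False
      then show ?thesis
        using T_Int[of x i j] fq_A[of x] that by auto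
    qed simp
  qed (use T_cover T_closed fq_cont in auto)
  have q_A: "q x = None" if "x \<in> A" for x
    using q_fq[of n x] that A_sub by (auto simp: T_def fq_def)
  have q_E: "q x = wedge_point i (cis (2 * pi * s i x))" if "i < n" "x \<in> E i" for i x
    using q_fq[of i x] that cover by (auto simp: T_def fq_def)
  have E_A: "x \<in> A" if "i < n" "x \<in> E i" "s i x \<in> {0, 1}" for i x
    using es[OF that(1,2)] ends[OF that(1)] that(3) by auto
  have q_None: "x \<in> A" if x: "x \<in> topspace X" "q x = None" for x
  proof -
    have "x \<in> A" if i: "i < n" "x \<in> E i" for i
    proof -
      have "cis (2 * pi * s i x) = 1"
        using q_E[OF i] x by (simp add: wedge_point_def split: if_splits)
      then show ?thesis
        using cis_two_pi_eq_1[OF s01[OF i]] E_A[OF i] by blast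
    qed
    then show ?thesis
      using x cover by blast
  qed
  \<comment> \<open>\<open>q\<close> identifies points only within \<open>A\<close>: off
    \<open>A\<close>, the image reveals both the arc and the parameter, which lies strictly between
    0 and 1.\<close>
  have q_inj: "x = y \<or> (x \<in> A \<and> y \<in> A)" if xy: "x \<in> topspace X" "y \<in> topspace X" "q x = q y" for x y
  proof (cases "q x = None")
    case True
    then show ?thesis
      using q_None xy by auto
  next
    case False
    then have xyA: "x \<notin> A" "y \<notin> A"
      using xy(3) q_A by auto
    then obtain i j where ij: "i < n" "x \<in> E i" "j < n" "y \<in> E j"
      using xy(1,2) cover by blast
    then have "i = j" "cis (2 * pi * s i x) = cis (2 * pi * s i y)"
      using q_E[OF ij(1,2)] q_E[OF ij(3,4)] xy(3) False
      by (simp_all add: wedge_point_def split: if_splits)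
    moreover have "s i x \<in> {0<..<1}"
      using s01[of i x] E_A[of i x] ij xyA by fastforce
    moreover have "s j y \<in> {0<..<1}"
      using s01[of j y] E_A[of j y] ij xyA by fastforce
    ultimately have "s i x = s i y"
      using cis_two_pi_eq_iff by blast
    then show ?thesis
      using es \<open>i = j\<close> ij by metis
  qed
  have q_surj: "q ` topspace X = topspace ?W"
  proof
    show "q ` topspace X \<subseteq> topspace ?W"
      using q by (simp add: continuous_map_image_subset_topspace)
    show "topspace ?W \<subseteq> q ` topspace X"
    proof
      fix w
      assume "w \<in> topspace ?W"
      then obtain i z where iz: "i < n" "z \<in> sphere 0 1" "w = wedge_point i z"
        by (auto simp: topspace_wedge_of_circles)
      obtain t where t: "t \<in> {0..1}" "cis (2 * pi * t) = z"
        using cis_two_pi_surj iz by blast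
      have "q (e i t) = w"
        using q_E[of i "e i t"] se[OF iz(1) t(1)] iz t by simp
      moreover have "e i t \<in> topspace X"
        using se[OF iz(1) t(1)] cover iz by blast
      ultimately show "w \<in> q ` topspace X"
        by blast
    qed
  qed

  obtain a HA where HA: "continuous_map (prod_topology ?I (subtopology X A)) (subtopology X A) HA"
    and HA0: "\<And>x. HA (0, x) = x" and HA1: "\<And>x. HA (1, x) = a"
    using A(2) unfolding contractible_space_def homotopic_with_def by auto
  have HA': "continuous_map (prod_topology ?I (subtopology X A)) X HA"
    using HA continuous_map_into_fulltopology by blast
  have HA_in: "HA (t, x) \<in> A" if "t \<in> {0..1}" "x \<in> A" for t x
    using continuous_map_image_subset_topspace[OF HA] that A_sub by (auto simp: image_subset_iff)
  have track: "continuous_map (top_of_set S) X (\<lambda>u. HA (f u, y))"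
    if "continuous_on S f" "f ` S \<subseteq> {0..1}" "y \<in> A" for S f y
  proof -
    have "continuous_map (top_of_set S) (prod_topology ?I (subtopology X A)) (\<lambda>u. (f u, y))"
      using that A_sub by (auto simp: continuous_map_pairwise o_def)
    from continuous_map_compose[OF this HA'] show ?thesis
      by (simp add: o_def)
  qed
  \<comment> \<open>\<open>P i\<close> is a loop at \<open>a\<close>: backwards along the track of
    \<open>e i 0\<close>, through the arc, then out along the track of \<open>e i 1\<close>. The
    pieces fit because \<open>HA\<close> at time 0 is the identity.\<close>
  define P where "P = (\<lambda>i u. if u \<le> 0 then HA (- u, e i 0) else
      if 1 \<le> u then HA (u - 1, e i 1) else e i u)"
  have P: "continuous_map (top_of_set {-1..2}) X (P i)" if i: "i < n" for i
    unfolding P_def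
  proof (rule continuous_map_cases_le)
    have "continuous_map (top_of_set {-1..0}) X (\<lambda>u. HA (- u, e i 0))"
      using ends[OF i] by (intro track) (auto intro!: continuous_intros)
    moreover have "{-1..2} \<inter> {x. (-1 \<le> x \<and> x \<le> 2) \<and> x \<le> (0::real)} = {-1..0}"
      by auto
    ultimately show "continuous_map (subtopology (top_of_set {-1..2})
        {x \<in> topspace (top_of_set {-1..2}). x \<le> 0}) X (\<lambda>u. HA (- u, e i 0))"
      by (simp add: subtopology_subtopology)
    have "continuous_map (top_of_set {0..2}) X (\<lambda>u. if 1 \<le> u then HA (u - 1, e i 1) else e i u)"
    proof (rule continuous_map_cases_le)
      have "continuous_map (top_of_set {1..2}) X (\<lambda>u. HA (u - 1, e i 1))"
        using ends[OF i] by (intro track) (auto intro!: continuous_intros)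
      moreover have "{0..2} \<inter> {x. (0 \<le> x \<and> x \<le> 2) \<and> 1 \<le> (x::real)} = {1..2}"
        by auto
      ultimately show "continuous_map (subtopology (top_of_set {0..2})
          {x \<in> topspace (top_of_set {0..2}). 1 \<le> x}) X (\<lambda>u. HA (u - 1, e i 1))"
        by (simp add: subtopology_subtopology)
      have "{0..2} \<inter> {x. (0 \<le> x \<and> x \<le> 2) \<and> (x::real) \<le> 1} = {0..1}"
        by auto
      then show "continuous_map (subtopology (top_of_set {0..2})
          {x \<in> topspace (top_of_set {0..2}). x \<le> 1}) X (e i)"
        using ce[OF i] by (simp add: subtopology_subtopology)
    qed (use HA0 in \<open>auto simp: continuous_map_in_subtopology\<close>)
    moreover have "{-1..2} \<inter> {x. (-1 \<le> x \<and> x \<le> 2) \<and> (0::real) \<le> x} = {0..2}"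
      by auto
    ultimately show "continuous_map (subtopology (top_of_set {-1..2})
        {x \<in> topspace (top_of_set {-1..2}). 0 \<le> x}) X
        (\<lambda>u. if 1 \<le> u then HA (u - 1, e i 1) else e i u)"
      by (simp add: subtopology_subtopology)
  qed (use HA0 in \<open>auto simp: continuous_map_in_subtopology\<close>)

  \<comment> \<open>The affine map \<open>(1 + 2 * t) * s - t\<close> takes [0, 1] onto [-t, 1 + t].
    At its ends \<open>P i\<close> has the values \<open>HA (t, e i 0)\<close> and
    \<open>HA (t, e i 1)\<close>, so the pieces agree on \<open>A\<close>.\<close>
  define fH where "fH = (\<lambda>i (t, x). if i < n then P i ((1 + 2 * t) * s i x - t) else HA (t, x))"
  have fH_A: "fH i (t, x) = HA (t, x)" if "x \<in> T i" "x \<in> A" "t \<in> {0..1}" for i t x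
  proof (cases "i < n")
    case True
    then have i: "x \<in> E i" "s i x = 0 \<or> s i x = 1" "e i (s i x) = x"
      using int[OF True, of x] es[OF True, of x] that by (auto simp: T_def)
    then show ?thesis
      using True that by (auto simp: fH_def P_def)
  qed (simp add: fH_def)
  have fH_cont: "continuous_map (subtopology (prod_topology ?I X) ({0..1} \<times> T i)) X (fH i)" for i
  proof (cases "i < n")
    case True
    let ?Z = "prod_topology ?I (subtopology X (E i))"
    have st: "continuous_map ?Z euclideanreal (\<lambda>z. s i (snd z))"
      using continuous_map_compose[OF continuous_map_snd cs[OF True]] by (simp add: o_def)
    have t: "continuous_map ?Z euclideanreal fst"
      using continuous_map_fst continuous_map_into_fulltopology by blast
    have "continuous_map ?Z euclideanreal (\<lambda>z. (1 + 2 * fst z) * s i (snd z) - fst z)"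
      by (intro continuous_map_add continuous_map_diff continuous_map_real_mult st t) auto
    moreover have "(1 + 2 * t) * s i x - t \<in> {-1..2}" if "t \<in> {0..1}" "x \<in> E i" for t x
    proof -
      have "(1 + 2 * t) * s i x \<le> (1 + 2 * t) * 1" "0 \<le> (1 + 2 * t) * s i x"
        using s01[OF True that(2)] that(1) by (intro mult_left_mono mult_nonneg_nonneg; simp)+
      then show ?thesis
        using that(1) by (simp add: algebra_simps)
    qed
    ultimately have "continuous_map ?Z (top_of_set {-1..2}) (\<lambda>z. (1 + 2 * fst z) * s i (snd z) - fst z)"
      by (auto simp: continuous_map_in_subtopology)
    from continuous_map_compose[OF this P[OF True]] show ?thesis
      using True by (simp add: T_def fH_def subtopology_Times subtopology_subtopology o_def case_prod_unfold)
  next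
    case False
    then show ?thesis
      using HA' by (simp add: T_def fH_def subtopology_Times subtopology_subtopology)
  qed
  obtain H where H: "continuous_map (prod_topology ?I X) X H"
    and H_fH: "\<And>z i. i \<in> {..n} \<Longrightarrow> z \<in> topspace (prod_topology ?I X) \<inter> ({0..1} \<times> T i) \<Longrightarrow> H z = fH i z"
  proof (rule pasting_lemma_exists_closed[of "{..n}" "prod_topology ?I X" "\<lambda>i. {0..1} \<times> T i" X fH])
    show "fH i z = fH j z" if "i \<in> {..n}" "j \<in> {..n}"
      "z \<in> topspace (prod_topology ?I X) \<inter> ({0..1} \<times> T i) \<inter> ({0..1} \<times> T j)" for i j z
    proof (cases "i = j")
      case False
      obtain t x where "z = (t, x)"
        by fastforce
      then show ?thesis
        using T_Int[of x i j] fH_A[of x _ t] that False by auto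
    qed simp
    show "closedin (prod_topology ?I X) ({0..1} \<times> T i)" for i
      using T_closed by (simp add: closedin_prod_Times_iff)
    show "topspace (prod_topology ?I X) \<subseteq> (\<Union>i\<le>n. {0..1} \<times> T i)"
      using T_cover by auto
  qed (use fH_cont in auto)
  have H_A: "H (t, x) = HA (t, x)" if "t \<in> {0..1}" "x \<in> A" for t x
    using H_fH[of n "(t, x)"] that A_sub by (auto simp: T_def fH_def)
  have H0: "H (0, x) = x" if x: "x \<in> topspace X" for x
  proof (cases "x \<in> A")
    case True
    then show ?thesis
      using H_A HA0 by simp
  next
    case False
    then obtain i where i: "i < n" "x \<in> E i"
      using x cover by blast
    then have "s i x \<in> {0<..<1}"
      using s01[OF i] E_A[OF i] False by fastforce
    then show ?thesis
      using H_fH[of i "(0, x)"] i x es[OF i] by (auto simp: T_def fH_def P_def)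
  qed
  \<comment> \<open>Distinct points with the same image under \<open>q\<close> lie in
    \<open>A\<close>. There \<open>H\<close> is the contraction \<open>HA\<close>, which stays in
    \<open>A\<close>, where \<open>q\<close> is constant, and ends at the single point
    \<open>a\<close>.\<close>
  show ?thesis
  proof (rule quotient_homotopy_equivalent[OF X Hausdorff_wedge_of_circles q q_surj H H0])
    fix x y and t :: real
    assume xy: "x \<in> topspace X" "y \<in> topspace X" "q x = q y"
    show "H (1, x) = H (1, y)"
      using q_inj[OF xy] H_A HA1 by auto
    assume "t \<in> {0..1}"
    then show "q (H (t, x)) = q (H (t, y))"
      using q_inj[OF xy] H_A HA_in q_A by auto
  qed
qed

section \<open>Connected graphs\<close>

text \<open>Replaces the condition on the support by equations and weak inequalities between
  coordinates, which visibly define a closed set.\<close>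

lemma polyhedron_Pow:
  assumes "finite \<sigma>"
  shows "polyhedron (Pow \<sigma>) = {x. (\<forall>v. 0 \<le> x v) \<and> (\<forall>v. v \<notin> \<sigma> \<longrightarrow> x v = 0) \<and> sum x \<sigma> = 1}"
proof (intro equalityI subsetI)
  fix x :: "'a \<Rightarrow> real"
  assume x: "x \<in> polyhedron (Pow \<sigma>)"
  then have "{v. x v \<noteq> 0} \<subseteq> \<sigma>"
    by (simp add: polyhedron_def)
  then show "x \<in> {x. (\<forall>v. 0 \<le> x v) \<and> (\<forall>v. v \<notin> \<sigma> \<longrightarrow> x v = 0) \<and> sum x \<sigma> = 1}"
    using x sum_polyhedron[OF x _ assms] by (auto simp: polyhedron_def)
next
  fix x :: "'a \<Rightarrow> real"
  assume "x \<in> {x. (\<forall>v. 0 \<le> x v) \<and> (\<forall>v. v \<notin> \<sigma> \<longrightarrow> x v = 0) \<and> sum x \<sigma> = 1}"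
  then show "x \<in> polyhedron (Pow \<sigma>)"
    using assms by (intro polyhedronI[where S = \<sigma>]) auto
qed

lemma closedin_simplex:
  assumes "finite \<sigma>"
  shows "closedin (powertop_real UNIV) (polyhedron (Pow \<sigma>))"
proof -
  have "closed {x :: 'a \<Rightarrow> real. (\<forall>v. 0 \<le> x v) \<and> (\<forall>v. v \<notin> \<sigma> \<longrightarrow> x v = 0) \<and> sum x \<sigma> = 1}"
    by (intro closed_Collect_conj closed_Collect_all closed_Collect_imp closed_Collect_le
        closed_Collect_eq continuous_on_const continuous_on_sum continuous_on_product_coordinates open_Collect_const)
  then show ?thesis
    by (simp add: polyhedron_Pow[OF assms] euclidean_product_topology)
qed

text \<open>A closed simplex is a closed subset of the cube of all functions with values in [0, 1],
  which is compact by Tychonoff's theorem.\<close>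

lemma compactin_simplex:
  assumes "finite \<sigma>"
  shows "compactin (powertop_real UNIV) (polyhedron (Pow \<sigma>))"
proof (rule closed_compactin)
  show "compactin (powertop_real UNIV) (PiE UNIV (\<lambda>_ :: 'a. {0..1}))"
    by (simp add: compactin_PiE)
  have "x v \<le> 1" if "x \<in> polyhedron (Pow \<sigma>)" for x v
  proof (cases "v \<in> \<sigma>")
    case True
    then show ?thesis
      using member_le_sum[of v \<sigma> x] that assms by (simp add: polyhedron_Pow)
  qed (use that assms in \<open>simp add: polyhedron_Pow\<close>)
  then show "polyhedron (Pow \<sigma>) \<subseteq> PiE UNIV (\<lambda>_. {0..1})"
    by (auto simp: polyhedron_def)
qed (rule closedin_simplex[OF assms])

lemma polyhedron_eq_Union_simplices:
  assumes "simplicial_complex K"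
  shows "polyhedron K = (\<Union>\<sigma>\<in>K. polyhedron (Pow \<sigma>))"
proof (intro equalityI subsetI)
  fix x
  assume "x \<in> polyhedron K"
  then show "x \<in> (\<Union>\<sigma>\<in>K. polyhedron (Pow \<sigma>))"
    by (force simp: polyhedron_def)
next
  fix x
  assume "x \<in> (\<Union>\<sigma>\<in>K. polyhedron (Pow \<sigma>))"
  then obtain \<sigma> where \<sigma>: "\<sigma> \<in> K" "x \<in> polyhedron (Pow \<sigma>)"
    by auto
  then have "{v. x v \<noteq> 0} \<in> K"
    using simplicial_complexD(3)[OF assms \<sigma>(1)] support_nonempty[OF \<sigma>(2)] support_in_complex[OF \<sigma>(2)] by blast
  then show "x \<in> polyhedron K"
    using \<sigma> by (simp add: polyhedron_def)
qed

lemma compact_space_geometric_realization: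
  assumes "simplicial_complex K"
  shows "compact_space (geometric_realization K)"
  unfolding geometric_realization_polyhedron polyhedron_eq_Union_simplices[OF assms]
  using simplicial_complexD[OF assms] compactin_simplex
  by (intro compact_space_subtopology compactin_Union) auto

lemma closedin_subcomplex:
  assumes "simplicial_complex L" "polyhedron L \<subseteq> polyhedron K"
  shows "closedin (geometric_realization K) (polyhedron L)"
proof -
  have "closedin (powertop_real UNIV) (polyhedron L)"
    unfolding polyhedron_eq_Union_simplices[OF assms(1)]
    using simplicial_complexD[OF assms(1)] closedin_simplex by (intro closedin_Union) auto
  then show ?thesis
    unfolding geometric_realization_polyhedron using assms(2) by (rule closedin_subset_topspace)
qed

lemma polyhedron_vertex: "polyhedron {{v}} = {\<lambda>u. if u = v then 1 else 0}"
proof (intro equalityI subsetI)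
  fix x :: "'a \<Rightarrow> real"
  assume x: "x \<in> polyhedron {{v}}"
  then have supp: "{u. x u \<noteq> 0} = {v}"
    by (simp add: polyhedron_def)
  then have "x v = 1"
    using sum_polyhedron[OF x, of "{v}"] by simp
  moreover have "x u = 0" if "u \<noteq> v" for u
    using supp that by blast
  ultimately show "x \<in> {\<lambda>u. if u = v then 1 else 0}"
    by (simp add: fun_eq_iff)
next
  fix x :: "'a \<Rightarrow> real"
  assume "x \<in> {\<lambda>u. if u = v then 1 else 0}"
  then show "x \<in> polyhedron {{v}}"
    by (intro polyhedronI[where S = "{v}"]) auto
qed

lemma contractible_vertex: "contractible_space (geometric_realization {{v}})"
  by (rule contractible_space_subset_singleton) (simp add: polyhedron_vertex)

section \<open>Contractible subcomplexes through all vertices\<close>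

text \<open>If no edge left \<open>V\<close>, every simplex would have all or none of its vertices
  in \<open>V\<close>. The total weight on \<open>V\<close> would then be a continuous function with
  only the values 0 and 1, both attained at vertices, against connectedness.\<close>

lemma connected_complex_crossing_edge:
  assumes \<Gamma>: "simplicial_complex \<Gamma>" and conn: "connected_space (geometric_realization \<Gamma>)"
    and p: "{p} \<in> \<Gamma>" "p \<in> V" and r: "{r} \<in> \<Gamma>" "r \<notin> V"
  obtains a u where "{a, u} \<in> \<Gamma>" "a \<in> V" "u \<notin> V"
proof (rule ccontr)
  assume "\<not> thesis"
  then have no: "u \<in> V" if "{a, u} \<in> \<Gamma>" "a \<in> V" for a u
    using that \<open>\<not> thesis\<close> \<open>\<And>u a. {a, u} \<in> \<Gamma> \<Longrightarrow> a \<in> V \<Longrightarrow> u \<notin> V \<Longrightarrow> thesis\<close> by blast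
  let ?U = "\<Union>\<Gamma> \<inter> V"
  let ?\<phi> = "\<lambda>x :: 'a \<Rightarrow> real. sum x ?U"
  have fin: "finite ?U"
    using simplicial_complexD[OF \<Gamma>] by auto
  have cont: "continuous_map (geometric_realization \<Gamma>) euclideanreal ?\<phi>"
    using fin by (intro continuous_map_sum continuous_map_coordinate[OF continuous_map_id[unfolded id_def]]) auto
  have dichotomy: "?\<phi> x \<in> {0, 1}" if x: "x \<in> polyhedron \<Gamma>" for x
  proof (cases "{v. x v \<noteq> 0} \<inter> V = {}")
    case True
    then show ?thesis
      by (auto intro!: sum.neutral)
  next
    case False
    define \<sigma> where "\<sigma> = {v. x v \<noteq> 0}"
    have \<sigma>: "\<sigma> \<in> \<Gamma>"
      using support_in_complex[OF x] by (simp add: \<sigma>_def)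
    obtain a where a: "a \<in> \<sigma>" "a \<in> V"
      using False by (auto simp: \<sigma>_def)
    have "u \<in> V" if u: "u \<in> \<sigma>" for u
      using simplicial_complexD(3)[OF \<Gamma> \<sigma>, of "{a, u}"] no[of a u] a u by simp
    then have "\<sigma> \<subseteq> ?U"
      using \<sigma> by auto
    then show ?thesis
      using sum_polyhedron[OF x] fin by (simp add: \<sigma>_def)
  qed
  have "connectedin euclideanreal (?\<phi> ` polyhedron \<Gamma>)"
    using connectedin_continuous_map_image[OF cont, of "polyhedron \<Gamma>"] conn
    by (simp add: connectedin_def subtopology_topspace flip: topspace_geometric_realization)
  then have im: "topological_space_class.connected (?\<phi> ` polyhedron \<Gamma>)"
    by simp
  have vertex: "(\<lambda>u. if u = v then 1 else 0) \<in> polyhedron \<Gamma>" if "{v} \<in> \<Gamma>" for v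
    using polyhedron_vertex[of v] polyhedron_mono[of "{{v}}" \<Gamma>] that by auto
  have "1 \<in> ?\<phi> ` polyhedron \<Gamma>"
    using p fin by (intro image_eqI[OF _ vertex[OF p(1)]]) auto
  moreover have "0 \<in> ?\<phi> ` polyhedron \<Gamma>"
    using r fin by (intro image_eqI[OF _ vertex[OF r(1)]]) auto
  ultimately have "1 / 2 \<in> ?\<phi> ` polyhedron \<Gamma>"
    using connectedD_interval[OF im, of 0 1 "1 / 2"] by simp
  then obtain x where "1 / 2 = ?\<phi> x" "x \<in> polyhedron \<Gamma>"
    by (rule imageE)
  then show False
    using dichotomy[of x] by auto
qed

text \<open>This plays the role of a spanning tree. If a maximal contractible subcomplex missed a
  vertex, some edge would lead from it to a new vertex; adding both keeps it contractible, since the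
  new edge collapses back.\<close>

lemma spanning_contractible_subcomplex:
  assumes \<Gamma>: "simplicial_complex \<Gamma>" and conn: "connected_space (geometric_realization \<Gamma>)"
    and ne: "polyhedron \<Gamma> \<noteq> {}"
  obtains A where "A \<subseteq> \<Gamma>" "simplicial_complex A" "contractible_space (geometric_realization A)"
    "polyhedron A \<noteq> {}" "\<And>v. {v} \<in> \<Gamma> \<Longrightarrow> {v} \<in> A"
proof -
  let ?P = "\<lambda>A. A \<subseteq> \<Gamma> \<and> simplicial_complex A \<and> contractible_space (geometric_realization A) \<and>
    polyhedron A \<noteq> {}"
  obtain x where x: "x \<in> polyhedron \<Gamma>"
    using ne by blast
  obtain v where "v \<in> {v. x v \<noteq> 0}"
    using support_nonempty[OF x] by blast
  then have v: "{v} \<in> \<Gamma>"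
    using simplicial_complexD(3)[OF \<Gamma> support_in_complex[OF x], of "{v}"] by simp
  have "simplicial_complex {{v}}"
    by (auto simp: simplicial_complex_def)
  define F where "F = {A. ?P A}"
  have "{{v}} \<in> F"
    using v contractible_vertex \<open>simplicial_complex {{v}}\<close> by (simp add: F_def polyhedron_vertex)
  moreover have "finite F"
    unfolding F_def using simplicial_complexD(1)[OF \<Gamma>]
    by (rule_tac finite_subset[of _ "Pow \<Gamma>"]) auto
  ultimately have "\<exists>A\<in>F. \<forall>B\<in>F. A \<subseteq> B \<longrightarrow> A = B"
    by (intro finite_has_maximal) auto
  then obtain A where "A \<in> F" and "\<forall>B\<in>F. A \<subseteq> B \<longrightarrow> A = B"
    by blast
  then have max: "?P B \<Longrightarrow> A \<subseteq> B \<Longrightarrow> A = B" for B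
    by (simp add: F_def)
  have A: "A \<subseteq> \<Gamma>" "simplicial_complex A" "contractible_space (geometric_realization A)"
    "polyhedron A \<noteq> {}"
    using \<open>A \<in> F\<close> by (simp_all add: F_def)
  have "{r} \<in> A" if r: "{r} \<in> \<Gamma>" for r
  proof (rule ccontr)
    assume "{r} \<notin> A"
    obtain y where y: "y \<in> polyhedron A"
      using A by blast
    obtain p where "p \<in> {v. y v \<noteq> 0}"
      using support_nonempty[OF y] by blast
    then have p: "{p} \<in> A"
      using simplicial_complexD(3)[OF A(2) support_in_complex[OF y], of "{p}"] by simp
    obtain a u where au: "{a, u} \<in> \<Gamma>" "{a} \<in> A" "{u} \<notin> A"
      using connected_complex_crossing_edge[OF \<Gamma> conn, of p "{v. {v} \<in> A}" r] p r \<open>{r} \<notin> A\<close> A(1)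
      by auto
    define B where "B = insert {u} (insert {a, u} A)"
    have "a \<noteq> u"
      using au by auto
    have new: "\<rho> \<notin> A" if "u \<in> \<rho>" for \<rho>
      using simplicial_complexD(3)[OF A(2), of \<rho> "{u}"] au that by auto
    have B: "simplicial_complex B"
      unfolding simplicial_complex_def
    proof (intro conjI ballI allI impI)
      fix \<sigma> \<tau>
      assume "\<sigma> \<in> B" "\<tau> \<subseteq> \<sigma>" "\<tau> \<noteq> {}"
      then consider "\<sigma> \<in> A" | "\<tau> \<subseteq> {a, u}"
        by (auto simp: B_def)
      then show "\<tau> \<in> B"
      proof cases
        case 1
        then show ?thesis
          using simplicial_complexD(3)[OF A(2)] \<open>\<tau> \<subseteq> \<sigma>\<close> \<open>\<tau> \<noteq> {}\<close> by (auto simp: B_def)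
      next
        case 2
        then have "\<tau> = {a} \<or> \<tau> = {u} \<or> \<tau> = {a, u}"
          using \<open>\<tau> \<noteq> {}\<close> by blast
        then show ?thesis
          using au by (auto simp: B_def)
      qed
    qed (use simplicial_complexD[OF A(2)] in \<open>auto simp: B_def\<close>)
    have diff: "B - {{a, u}, {u}} = A"
      using new by (auto simp: B_def)
    obtain f where
      "homotopic_with (\<lambda>_. True) (geometric_realization B) (geometric_realization B) (id \<circ> f) id"
      "retraction_maps (geometric_realization B) (geometric_realization (B - {{a, u}, {u}})) f id"
    \<comment> \<open>The new vertex \<open>u\<close> is the free face, and the collapse pushes the
      edge towards \<open>a\<close>.\<close>
    proof (rule elementary_collapse[OF B, of "{a, u}" a "{u}"])
      show "\<rho> = {u} \<or> \<rho> = {a, u}" if "\<rho> \<in> B" "{u} \<subseteq> \<rho>" for \<rho>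
        using that new by (auto simp: B_def)
    qed (use \<open>a \<noteq> u\<close> in \<open>auto simp: B_def\<close>)
    then have "geometric_realization B homotopy_equivalent_space geometric_realization A"
      using deformation_retraction_imp_homotopy_equivalent_space diff by metis
    then have "contractible_space (geometric_realization B)"
      using A homotopy_equivalent_space_contractibility by blast
    moreover have "B \<subseteq> \<Gamma>"
      using A au simplicial_complexD(3)[OF \<Gamma> au(1), of "{u}"] by (auto simp: B_def)
    moreover have "A \<subseteq> B"
      by (auto simp: B_def)
    ultimately have "A = B"
      using max[of B] B A polyhedron_mono[of A B] by blast
    then show False
      using au by (auto simp: B_def)
  qed
  then show ?thesis
    using that A by blast
qed

text \<open>As \<open>A\<close> contains all vertices, the remaining nonempty simplices are edges
  with both ends in \<open>A\<close>, and these are the arcs to be turned into circles.\<close>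

lemma connected_graph_contractible_or_wedge:
  assumes \<Gamma>: "simplicial_complex \<Gamma>" and card: "\<And>\<sigma>. \<sigma> \<in> \<Gamma> \<Longrightarrow> card \<sigma> \<le> 2"
    and conn: "connected_space (geometric_realization \<Gamma>)" and ne: "polyhedron \<Gamma> \<noteq> {}"
  shows "contractible_space (geometric_realization \<Gamma>) \<or>
    (\<exists>n\<ge>1. geometric_realization \<Gamma> homotopy_equivalent_space wedge_of_circles n)"
proof -
  obtain A where A: "A \<subseteq> \<Gamma>" "simplicial_complex A" "contractible_space (geometric_realization A)"
    "polyhedron A \<noteq> {}" and vertices: "\<And>v. {v} \<in> \<Gamma> \<Longrightarrow> {v} \<in> A"
    using spanning_contractible_subcomplex[OF \<Gamma> conn ne] by blast
  \<comment> \<open>The empty simplex may belong to \<open>\<Gamma>\<close> without belonging to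
    \<open>A\<close>; it must not be counted as an arc.\<close>
  define M where "M = \<Gamma> - A - {{}}"
  define n where "n = card M"
  have "finite M"
    using simplicial_complexD[OF \<Gamma>] by (simp add: M_def)
  then obtain m where m: "bij_betw m {..<n} M"
    using ex_bij_betw_nat_finite[of M] by (auto simp: n_def atLeast0LessThan)
  have mM: "m i \<in> M" if "i < n" for i
    using m that by (auto simp: bij_betw_def)
  have "\<exists>a b. a \<noteq> b \<and> m i = {a, b}" if "i < n" for i
  proof -
    have i: "m i \<in> \<Gamma>" "m i \<notin> A" "m i \<noteq> {}"
      using mM[OF that] by (auto simp: M_def)
    have "finite (m i)"
      using simplicial_complexD(2)[OF \<Gamma>] i by blast
    have "card (m i) \<noteq> 1"
      using vertices i by (auto simp: card_1_singleton_iff)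
    then have "card (m i) = 2"
      using card[OF i(1)] i(3) \<open>finite (m i)\<close> by (simp add: le_Suc_eq numeral_2_eq_2)
    then show ?thesis
      by (auto simp: card_2_iff)
  qed
  then obtain a b where ab: "\<And>i. i < n \<Longrightarrow> a i \<noteq> b i \<and> m i = {a i, b i}"
    by metis
  \<comment> \<open>Without remaining edges no circle is available, and the contractible alternative
    must hold: \<open>A\<close> and \<open>\<Gamma>\<close> then differ at most in the empty
    simplex.\<close>
  have poly_A: "polyhedron A = polyhedron \<Gamma>" if "n = 0"
  proof -
    have "M = {}"
      using that \<open>finite M\<close> by (simp add: n_def)
    then have "\<Gamma> \<subseteq> insert {} A"
      by (auto simp: M_def)
    then show ?thesis
      using A(1) support_nonempty by (fastforce simp: polyhedron_def)
  qed
  show ?thesis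
  proof (cases "n = 0")
    case True
    then show ?thesis
      using A(3) poly_A by (simp add: geometric_realization_polyhedron)
  next
    case False
    let ?X = "geometric_realization \<Gamma>"
    define E where "E = (\<lambda>i. polyhedron (Pow (m i)))"
    define e where "e = (\<lambda>i (t :: real) v. if v = b i then t else if v = a i then 1 - t else 0)"
    have fin: "finite (m i)" if "i < n" for i
      using ab[OF that] by simp
    have E: "E i = {x. 0 \<le> x (a i) \<and> 0 \<le> x (b i) \<and> (\<forall>v. v \<noteq> a i \<and> v \<noteq> b i \<longrightarrow> x v = 0) \<and>
        x (a i) + x (b i) = 1}" if "i < n" for i
      unfolding E_def polyhedron_Pow[OF fin[OF that]] using ab[OF that] by (auto; metis order_refl)
    have E_sub: "E i \<subseteq> polyhedron \<Gamma>" if "i < n" for i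
      unfolding E_def polyhedron_eq_Union_simplices[OF \<Gamma>] using mM[OF that] by (auto simp: M_def)
    have A_sub: "polyhedron A \<subseteq> polyhedron \<Gamma>"
      using A by (rule_tac polyhedron_mono)
    have eE: "e i t \<in> E i" if "i < n" "t \<in> {0..1}" for i t
      unfolding E[OF that(1)] using that ab[OF that(1)] by (auto simp: e_def)
    have vertex_A: "x \<in> polyhedron A" if "x \<in> polyhedron \<Gamma>" "{v. x v \<noteq> 0} \<subseteq> {u}" for x u
    proof -
      have "{v. x v \<noteq> 0} = {u}"
        using support_nonempty[OF that(1)] that(2) by blast
      then show ?thesis
        using that vertices by (simp add: polyhedron_def)
    qed
    \<comment> \<open>The parameter on edge \<open>i\<close> is the barycentric coordinate at
      \<open>b i\<close>, so \<open>a i\<close> is the end with parameter 0.\<close>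
    have "?X homotopy_equivalent_space wedge_of_circles n"
    proof (rule contractible_with_arcs_homotopy_equivalent_wedge_of_circles
        [where A = "polyhedron A" and E = E and e = e and s = "\<lambda>i x. x (b i)"])
      show "compact_space ?X"
        by (rule compact_space_geometric_realization[OF \<Gamma>])
      show "closedin ?X (polyhedron A)"
        by (rule closedin_subcomplex[OF A(2) A_sub])
      show "contractible_space (subtopology ?X (polyhedron A))"
        using A by (simp flip: geometric_realization_mono)
      show "polyhedron A \<noteq> {}" "1 \<le> n"
        using A False by auto
      show "topspace ?X = polyhedron A \<union> (\<Union>i<n. E i)"
      proof
        show "topspace ?X \<subseteq> polyhedron A \<union> (\<Union>i<n. E i)"
        proof
          fix x
          assume "x \<in> topspace ?X"
          then have x: "x \<in> polyhedron \<Gamma>"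
            by simp
          show "x \<in> polyhedron A \<union> (\<Union>i<n. E i)"
          proof (cases "{v. x v \<noteq> 0} \<in> A")
            case True
            then show ?thesis
              using x by (simp add: polyhedron_def)
          next
            case False
            then have "{v. x v \<noteq> 0} \<in> M"
              using support_in_complex[OF x] support_nonempty[OF x] by (simp add: M_def)
            then obtain i where "i < n" "{v. x v \<noteq> 0} = m i"
              using m by (auto simp: bij_betw_def)
            then have "x \<in> E i"
              using x by (simp add: E_def polyhedron_def)
            then show ?thesis
              using \<open>i < n\<close> by blast
          qed
        qed
        show "polyhedron A \<union> (\<Union>i<n. E i) \<subseteq> topspace ?X"
          using E_sub A_sub by auto
      qed
      fix i
      assume i: "i < n"
      show "closedin ?X (E i)"
        using closedin_subcomplex[OF simplicial_complex_Pow[OF fin[OF i]]] E_sub[OF i] by (simp add: E_def)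
      show "continuous_map (subtopology ?X (E i)) euclideanreal (\<lambda>x. x (b i))"
        by (intro continuous_map_from_subtopology continuous_map_coordinate[OF continuous_map_id[unfolded id_def]])
      show "continuous_map (top_of_set {0..1}) ?X (e i)"
        unfolding continuous_map_into_geometric_realization
      proof (intro conjI allI)
        fix v
        show "continuous_map (top_of_set {0..1}) euclideanreal (\<lambda>t. e i t v)"
          unfolding e_def by (cases "v = b i"; cases "v = a i") (auto intro!: continuous_intros)
      qed (use eE[OF i] E_sub[OF i] in auto)
      show "x (b i) \<in> {0..1}" if "x \<in> E i" for x
        using that unfolding E[OF i] by auto
      show "e i (x (b i)) = x" if "x \<in> E i" for x
        using that ab[OF i] unfolding E[OF i] by (auto simp: e_def fun_eq_iff)
      show "e i t \<in> E i \<and> e i t (b i) = t" if "t \<in> {0..1}" for t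
        using eE[OF i that] by (simp add: e_def)
      have "e i 0 \<in> polyhedron \<Gamma>" "e i 1 \<in> polyhedron \<Gamma>"
        using eE[OF i, of 0] eE[OF i, of 1] E_sub[OF i] by auto
      moreover have "{v. e i 0 v \<noteq> 0} \<subseteq> {a i}" "{v. e i 1 v \<noteq> 0} \<subseteq> {b i}"
        by (auto simp: e_def split: if_splits)
      ultimately show "e i 0 \<in> polyhedron A \<and> e i 1 \<in> polyhedron A"
        using vertex_A by blast
      show "x (b i) \<in> {0, 1}" if x: "x \<in> E i" "x \<in> polyhedron A" for x
      proof (rule ccontr)
        assume "x (b i) \<notin> {0, 1}"
        then have "{v. x v \<noteq> 0} = m i"
          using x(1) ab[OF i] unfolding E[OF i] by auto
        then show False
          using support_in_complex[OF x(2)] mM[OF i] by (simp add: M_def)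
      qed
      \<comment> \<open>Two distinct two-element sets share at most one point, and every vertex lies
        in \<open>A\<close>.\<close>
      show "E i \<inter> E j \<subseteq> polyhedron A" if j: "j < n" "i \<noteq> j" for j
      proof
        fix x
        assume "x \<in> E i \<inter> E j"
        then have x: "x \<in> polyhedron \<Gamma>" "{v. x v \<noteq> 0} \<subseteq> m i \<inter> m j"
          using E_sub[OF i] by (auto simp: E_def polyhedron_def)
        have "m i \<noteq> m j"
          using m i j by (auto simp: bij_betw_def inj_on_def)
        moreover have "card (m i) = card (m j)"
          using ab[OF i] ab[OF j(1)] by simp
        ultimately have "\<not> m i \<subseteq> m j"
          using card_subset_eq[OF fin[OF j(1)]] by blast
        then have "m i \<inter> m j \<subseteq> {a i} \<or> m i \<inter> m j \<subseteq> {b i}"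
          using ab[OF i] by auto
        then obtain u where "m i \<inter> m j \<subseteq> {u}"
          by blast
        then show "x \<in> polyhedron A"
          using vertex_A[OF x(1), of u] x(2) by (meson order_trans)
      qed
    qed
    then show ?thesis
      using False by (intro disjI2 exI[of _ n]) simp
  qed
qed

section \<open>Complexes without free faces\<close>

text \<open>If every edge of a triangle lies in a second triangle, then the three neighborhoods containing
  a vertex of it cover the three edges of a triangle in its link, so the triangles around it form the
  boundary of a tetrahedron.\<close>

lemma tetrahedron_if_no_free_face:
  fixes N :: "'a \<Rightarrow> 'a set"
  assumes sym: "\<And>u v. u \<in> N v \<longleftrightarrow> v \<in> N u"
    and fin: "\<And>v. finite (N v)" and deg: "\<And>v. card (N v) \<le> 3"
    and L: "\<And>\<sigma>. \<sigma> \<in> L \<Longrightarrow> \<exists>w. \<sigma> \<subseteq> N w"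
    and no_free: "\<And>\<sigma> v. \<sigma> \<in> L \<Longrightarrow> card \<sigma> = 3 \<Longrightarrow> v \<in> \<sigma> \<Longrightarrow>
      \<exists>\<rho>\<in>L. \<sigma> - {v} \<subseteq> \<rho> \<and> \<rho> \<noteq> \<sigma> \<and> \<rho> \<noteq> \<sigma> - {v}"
    and \<sigma>: "\<sigma> \<in> L" "card \<sigma> = 3"
  obtains v a b c w1 w2 w3 w4 where "distinct [v, a, b, c]"
    "N w1 = {v, a, b}" "N w2 = {v, a, c}" "N w3 = {v, b, c}" "N w4 = {a, b, c}"
    "N v = {w1, w2, w3}" "N a = {w1, w2, w4}" "N b = {w1, w3, w4}" "N c = {w2, w3, w4}"
proof -
  \<comment> \<open>The second simplex on the edge has at least three vertices and lies in a
    neighborhood of at most three, so it is a triangle equal to a whole neighborhood.\<close>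
  have other: "\<exists>u w. u \<notin> {x, y, z} \<and> {x, y, u} \<in> L \<and> N w = {x, y, u}"
    if xyz: "{x, y, z} \<in> L" "x \<noteq> y" "x \<noteq> z" "y \<noteq> z" for x y z
  proof -
    have "{x, y, z} - {z} = {x, y}" "card {x, y, z} = 3"
      using xyz by auto
    then obtain \<rho> where \<rho>: "\<rho> \<in> L" "{x, y} \<subseteq> \<rho>" "\<rho> \<noteq> {x, y, z}" "\<rho> \<noteq> {x, y}"
      using no_free[OF xyz(1), of z] by auto
    obtain w where w: "\<rho> \<subseteq> N w"
      using L[OF \<rho>(1)] by blast
    have "finite \<rho>"
      using w fin finite_subset by blast
    obtain u where u: "u \<in> \<rho>" "u \<notin> {x, y}"
      using \<rho> by blast
    then have sub: "{x, y, u} \<subseteq> \<rho>" "{x, y, u} \<subseteq> N w" "card {x, y, u} = 3"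
      using \<rho> w xyz by auto
    have "{x, y, u} = N w"
      using sub deg[of w] fin[of w] by (intro card_seteq) auto
    then have "\<rho> = {x, y, u}" "N w = {x, y, u}"
      using sub w by auto
    then show ?thesis
      using \<rho> u by blast
  qed
  have triple: "N u = {x, y, z}"
    if "x \<in> N u" "y \<in> N u" "z \<in> N u" "x \<noteq> y" "x \<noteq> z" "y \<noteq> z" for u x y z
  proof -
    have "{x, y, z} = N u"
      using that deg[of u] fin[of u] by (intro card_seteq) auto
    then show ?thesis
      by simp
  qed
  obtain v a b where \<sigma>_eq: "\<sigma> = {v, a, b}" and vab: "v \<noteq> a" "v \<noteq> b" "a \<noteq> b"
    using \<sigma>(2) by (auto simp: card_3_iff)
  have vab_L: "{v, a, b} \<in> L"
    using \<sigma> \<sigma>_eq by simp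
  obtain w1 where "\<sigma> \<subseteq> N w1"
    using L \<sigma> by blast
  then have w1: "N w1 = {v, a, b}"
    using \<sigma>_eq vab by (intro triple) auto
  obtain c w2 where c: "c \<notin> {v, a, b}" "{v, a, c} \<in> L" and w2: "N w2 = {v, a, c}"
    using other[OF vab_L vab] by blast
  have "{v, b, a} \<in> L"
    using vab_L by (simp add: insert_commute)
  then obtain d w3 where d: "d \<notin> {v, b, a}" and w3': "N w3 = {v, b, d}"
    using other[of v b a] vab by metis
  have "c \<in> N w2 - N w1" "d \<in> N w3 - N w1" "b \<in> N w3 - N w2"
    using w1 w2 w3' c d vab by auto
  then have w12: "w1 \<noteq> w2" and w13: "w1 \<noteq> w3" and w23: "w2 \<noteq> w3"
    by blast+
  have Nv: "N v = {w1, w2, w3}"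
    using w1 w2 w3' w12 w13 w23 sym[of _ v] by (intro triple) auto
  \<comment> \<open>The edge \<open>vc\<close> lies in a second triangle \<open>N w\<close>, where
    \<open>w\<close> is one of the three neighbors of \<open>v\<close>. It is not \<open>w1\<close>,
    whose neighborhood lacks \<open>c\<close>, nor \<open>w2\<close>, which gives the old triangle.
    So \<open>w = w3\<close>, which forces \<open>d = c\<close>.\<close>
  have "{v, c, a} \<in> L"
    using c by (simp add: insert_commute)
  then obtain u w where u: "u \<notin> {v, c, a}" and w: "N w = {v, c, u}"
    using other[of v c a] vab c by (metis insertCI)
  have "w \<in> {w1, w2, w3}"
    using Nv sym[of w v] w by auto
  moreover have "c \<in> N w - N w1" "u \<in> N w - N w2"
    using w w1 w2 c u by auto
  then have "w \<noteq> w1" "w \<noteq> w2"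
    by blast+
  ultimately have "c \<in> N w3"
    using w by auto
  then have "d = c"
    using w3' c by auto
  then have w3: "N w3 = {v, b, c}"
    using w3' by simp
  have "{a, b, v} \<in> L"
    using vab_L by (simp add: insert_commute)
  then obtain e w4 where e: "e \<notin> {a, b, v}" and w4': "N w4 = {a, b, e}"
    using other[of a b v] vab by metis
  have "v \<in> N w1 - N w4" "v \<in> N w2 - N w4" "v \<in> N w3 - N w4"
    using w1 w2 w3 w4' c e vab by auto
  then have w14: "w1 \<noteq> w4" and w24: "w2 \<noteq> w4" and w34: "w3 \<noteq> w4"
    by blast+
  have Na: "N a = {w1, w2, w4}"
    using w1 w2 w4' w12 w14 w24 sym[of _ a] by (intro triple) auto
  \<comment> \<open>The same argument at \<open>a\<close>: only \<open>w4\<close> can carry the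
    second triangle on the edge \<open>ac\<close>, so \<open>e = c\<close>.\<close>
  have "{a, c, v} \<in> L"
    using c by (simp add: insert_commute)
  then obtain u' w' where u': "u' \<notin> {a, c, v}" and w': "N w' = {a, c, u'}"
    using other[of a c v] vab c by (metis insertCI)
  have "w' \<in> {w1, w2, w4}"
    using Na sym[of w' a] w' by auto
  moreover have "c \<in> N w' - N w1" "u' \<in> N w' - N w2"
    using w' w1 w2 c u' vab by auto
  then have "w' \<noteq> w1" "w' \<noteq> w2"
    by blast+
  ultimately have "c \<in> N w4"
    using w' by auto
  then have "e = c"
    using w4' c by auto
  then have w4: "N w4 = {a, b, c}"
    using w4' by simp
  have Nb: "N b = {w1, w3, w4}"
    using w1 w3 w4 w13 w14 w34 sym[of _ b] by (intro triple) auto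
  have Nc: "N c = {w2, w3, w4}"
    using w2 w3 w4 w23 w24 w34 sym[of _ c] by (intro triple) auto
  show ?thesis
    by (rule that[OF _ w1 w2 w3 w4 Nv Na Nb Nc]) (use vab c in auto)
qed

section \<open>Recognition of the two exceptional graphs\<close>

text \<open>Arcs are pairs of vertices, so the vertex map determines the arc map, and injectivity on
  arcs is inherited from injectivity on vertices.\<close>

lemma digraph_iso_with_projI:
  assumes G: "pair_wf_digraph G" and \<phi>: "inj_on \<phi> (pverts G)" "\<phi> ` pverts G = pverts H"
    and arcs: "(\<lambda>(u, v). (\<phi> u, \<phi> v)) ` parcs G = parcs H"
  shows "digraph_iso (with_proj G) (with_proj H)"
proof -
  interpret pair_wf_digraph G
    by (rule G)
  let ?f = "\<lparr>iso_verts = \<phi>, iso_arcs = (\<lambda>(u, v). (\<phi> u, \<phi> v)), iso_head = snd, iso_tail = fst\<rparr>"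
  have "inj_on (\<lambda>(u, v). (\<phi> u, \<phi> v)) (parcs G)"
  proof (rule inj_onI, clarify)
    fix u v u' v'
    assume "(u, v) \<in> parcs G" "(u', v') \<in> parcs G" "\<phi> u = \<phi> u'" "\<phi> v = \<phi> v'"
    then show "u = u' \<and> v = v'"
      using wellformed' by (blast intro: inj_onD[OF \<phi>(1)])
  qed
  then have "pre_digraph.digraph_isomorphism (with_proj G) ?f"
    using \<phi>(1) wf_digraph_axioms by (auto simp: pre_digraph.digraph_isomorphism_def)
  moreover have "with_proj H = app_iso ?f (with_proj G)"
    using \<phi>(2) arcs by (simp add: app_iso_def with_proj_def)
  ultimately show ?thesis
    unfolding digraph_iso_def by blast
qed

text \<open>\<open>connected\<close> refers to walks in the symmetric closure. As \<open>G\<close>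
  is symmetric, each step of such a walk is an arc of \<open>G\<close>, and the walk cannot leave
  \<open>S\<close>.\<close>

lemma connected_subset_if_closed:
  assumes G: "pair_graph G" and conn: "Digraph_Component.connected (with_proj G)"
    and S: "u \<in> S" "u \<in> pverts G" and closed: "\<And>x y. x \<in> S \<Longrightarrow> (x, y) \<in> parcs G \<Longrightarrow> y \<in> S"
  shows "pverts G \<subseteq> S"
proof
  interpret pair_graph G
    by (rule G)
  have sym: "(y, x) \<in> parcs G" if "(x, y) \<in> parcs G" for x y
    using pair_sym_arcs that by (auto simp: symmetric_def dest: symD)
  fix v
  assume "v \<in> pverts G"
  then have "u \<rightarrow>\<^sup>*\<^bsub>with_proj (mk_symmetric (with_proj G))\<^esub> v"
    using conn S by (auto simp: connected_def strongly_connected_def mk_symmetric_def)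
  then have "(u, v) \<in> (parcs (mk_symmetric (with_proj G)))\<^sup>*"
    using reachable_rtranclI by fastforce
  then show "v \<in> S"
  proof (induction rule: rtrancl_induct)
    case (step x y)
    then have "(x, y) \<in> parcs G"
      using sym by (auto simp: mk_symmetric_def)
    then show ?case
      using closed step by blast
  qed (rule S)
qed

lemma K4_or_T_if_no_free_face:
  assumes G: "pair_graph G" and conn: "Digraph_Component.connected (with_proj G)"
    and deg: "\<And>w. card {v. (w, v) \<in> parcs G} \<le> 3"
    and L: "L \<subseteq> neighborhood_complex G"
    and no_free: "\<And>\<sigma> v. \<sigma> \<in> L \<Longrightarrow> card \<sigma> = 3 \<Longrightarrow> v \<in> \<sigma> \<Longrightarrow>
      \<exists>\<rho>\<in>L. \<sigma> - {v} \<subseteq> \<rho> \<and> \<rho> \<noteq> \<sigma> \<and> \<rho> \<noteq> \<sigma> - {v}"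
    and \<sigma>: "\<sigma> \<in> L" "card \<sigma> = 3"
  shows "digraph_iso (with_proj G) (with_proj K4_graph) \<or> digraph_iso (with_proj G) (with_proj T_graph)"
proof -
  interpret pair_graph G
    by (rule G)
  define N where "N = (\<lambda>u. {v. (u, v) \<in> parcs G})"
  have sym: "u \<in> N v \<longleftrightarrow> v \<in> N u" for u v
    using pair_sym_arcs by (auto simp: symmetric_def N_def dest: symD)
  have N_verts: "N u \<subseteq> pverts G" for u
    using wellformed' by (auto simp: N_def)
  then have fin: "finite (N u)" for u
    using pair_finite_verts finite_subset by blast
  have L_N: "\<exists>w. \<sigma> \<subseteq> N w" if "\<sigma> \<in> L" for \<sigma>
    using that L sym by (force simp: neighborhood_complex_def N_def)
  have deg_N: "card (N u) \<le> 3" for u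
    using deg by (simp add: N_def)
  obtain v a b c w1 w2 w3 w4 where vabc: "distinct [v, a, b, c]" and
    Nw: "N w1 = {v, a, b}" "N w2 = {v, a, c}" "N w3 = {v, b, c}" "N w4 = {a, b, c}" and
    Nv: "N v = {w1, w2, w3}" "N a = {w1, w2, w4}" "N b = {w1, w3, w4}" "N c = {w2, w3, w4}"
  proof (rule tetrahedron_if_no_free_face[OF sym fin deg_N L_N _ \<sigma>])
    show "\<exists>\<rho>\<in>L. \<sigma> - {v} \<subseteq> \<rho> \<and> \<rho> \<noteq> \<sigma> \<and> \<rho> \<noteq> \<sigma> - {v}"
      if "\<sigma> \<in> L" "card \<sigma> = 3" "v \<in> \<sigma>" for \<sigma> v
      by (rule no_free[OF that])
  qed blast+
  define X where "X = {v, a, b, c}"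
  define W where "W = {w1, w2, w3, w4}"
  have NX: "N x \<subseteq> W" if "x \<in> X" for x
    using that Nv by (auto simp: X_def W_def)
  have NW: "N x \<subseteq> X" if "x \<in> W" for x
    using that Nw by (auto simp: X_def W_def)
  have X_verts: "X \<subseteq> pverts G"
    using N_verts[of w1] N_verts[of w2] Nw by (auto simp: X_def)
  have W_verts: "W \<subseteq> pverts G"
    using N_verts[of v] N_verts[of a] Nv by (auto simp: W_def)
  have w_distinct: "distinct [w1, w2, w3, w4]"
    using Nw vabc by auto
  have arcs: "parcs G = Sigma (pverts G) N"
    using wellformed' by (auto simp: N_def)
  have wf: "pair_wf_digraph G"
    by unfold_locales
  have closed: "pverts G \<subseteq> S" if "u \<in> S" "u \<in> pverts G" "\<And>x. x \<in> S \<Longrightarrow> N x \<subseteq> S" for S u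
    using connected_subset_if_closed[OF G conn that(1,2)] that(3) by (auto simp: N_def)
  show ?thesis
  proof (cases "X \<inter> W = {}")
    case False
    then obtain u where u: "u \<in> X \<inter> W"
      by blast
    \<comment> \<open>A neighbor of a point of \<open>X \<inter> W\<close> lies in \<open>W\<close>
      and in \<open>X\<close>, so the intersection is closed under adjacency; being nonempty, it is
      everything.\<close>
    have "pverts G \<subseteq> X \<inter> W"
      using closed[of u "X \<inter> W"] u X_verts NX NW by blast
    then have V: "pverts G = X"
      using X_verts by blast
    have "N u = X - {u}" if "u \<in> X" for u
    proof (rule card_seteq)
      have "u \<notin> N u"
        using pair_no_loops[of "(u, u)"] by (auto simp: N_def)
      then show "N u \<subseteq> X - {u}"
        using N_verts V by auto
      show "card (X - {u}) \<le> card (N u)"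
        using that Nv vabc w_distinct by (auto simp: X_def)
    qed (simp add: X_def)
    then have arcs_X: "parcs G = Sigma X (\<lambda>u. X - {u})"
      using arcs V by auto
    define \<phi> where "\<phi> = (\<lambda>u. if u = v then 1 else if u = a then 2 else if u = b then 3 else 4 :: nat)"
    have \<phi>: "\<phi> v = 1" "\<phi> a = 2" "\<phi> b = 3" "\<phi> c = 4"
      using vabc by (auto simp: \<phi>_def)
    have inj: "inj_on \<phi> X"
      using \<phi> by (auto simp: X_def)
    have im: "\<phi> ` X = {1..4}"
      using \<phi> by (auto simp: X_def)
    have "(\<lambda>(u, v). (\<phi> u, \<phi> v)) ` Sigma X (\<lambda>u. X - {u}) = {(u, v). u \<in> \<phi> ` X \<and> v \<in> \<phi> ` X \<and> u \<noteq> v}"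
      using inj by (force simp: inj_on_def)
    then have "digraph_iso (with_proj G) (with_proj K4_graph)"
      using inj im V arcs_X
      by (intro digraph_iso_with_projI[OF wf, of \<phi>]) (auto simp: K4_graph_def undirected_graph_def)
    then show ?thesis
      by simp
  next
    case True
    have "pverts G \<subseteq> X \<union> W"
      using closed[of v "X \<union> W"] X_verts NX NW by (auto simp: X_def)
    then have V: "pverts G = {v, a, b, c, w1, w2, w3, w4}"
      using X_verts W_verts by (auto simp: X_def W_def)
    have dist: "distinct [v, a, b, c, w1, w2, w3, w4]"
      using True vabc w_distinct by (auto simp: X_def W_def)
    \<comment> \<open>The numbering is read off \<open>T_graph\<close>: its vertex 1 has the
      neighbors 2, 3, 4, so \<open>w1\<close> goes to 1. The other vertex of that side is 6, the
      image of \<open>c\<close>, and 8, 7, 5 are adjacent to the triples 2, 3, 6 and 2, 4, 6 and 3,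
      4, 6.\<close>
    define \<phi> where "\<phi> = (\<lambda>u. if u = v then 2 else if u = a then 3 else if u = b then 4 else if u = c then 6
      else if u = w1 then 1 else if u = w2 then 8 else if u = w3 then 7 else 5 :: nat)"
    have \<phi>: "\<phi> v = 2" "\<phi> a = 3" "\<phi> b = 4" "\<phi> c = 6" "\<phi> w1 = 1" "\<phi> w2 = 8" "\<phi> w3 = 7" "\<phi> w4 = 5"
      using dist by (auto simp: \<phi>_def)
    have inj: "inj_on \<phi> (pverts G)"
      unfolding V inj_on_def using \<phi> by simp
    have interval: "{1..8} = {1, 2, 3, 4, 5, 6, 7, 8 :: nat}"
      by auto
    have im: "\<phi> ` pverts G = pverts T_graph"
      unfolding V T_graph_def undirected_graph_def interval using \<phi> by auto
    have "parcs G = (\<Union>x\<in>pverts G. Pair x ` N x)"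
      unfolding arcs by auto
    then have parcs_G: "parcs G = {(v, w1), (v, w2), (v, w3), (a, w1), (a, w2), (a, w4), (b, w1), (b, w3), (b, w4),
      (c, w2), (c, w3), (c, w4)} \<union> {(w1, v), (w2, v), (w3, v), (w1, a), (w2, a), (w4, a), (w1, b), (w3, b),
      (w4, b), (w2, c), (w3, c), (w4, c)}"
      unfolding V by (auto simp: Nv Nw)
    have conv: "({(1,2), (1,3), (1,4), (2,7), (2,8), (4,7), (4,5), (3,5), (3,8), (5,6), (6,7), (6,8)} :: nat rel)\<inverse> =
        {(2,1), (3,1), (4,1), (7,2), (8,2), (7,4), (5,4), (5,3), (8,3), (6,5), (7,6), (8,6)}"
      by auto
    have "(\<lambda>(u, v). (\<phi> u, \<phi> v)) ` parcs G = parcs T_graph"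
      unfolding parcs_G T_graph_def undirected_graph_def pair_pre_digraph.simps conv image_Un
        image_insert image_empty prod.case \<phi>
      by (intro equalityI; simp)
    then have "digraph_iso (with_proj G) (with_proj T_graph)"
      using inj im by (intro digraph_iso_with_projI[OF wf])
    then show ?thesis
      by simp
  qed
qed

section \<open>Degree bounds, minimal subcomplexes and the conclusion\<close>

text \<open>Points outside the graph have no neighbors, so the bound is available for every
  \<open>w\<close> of the type.\<close>

lemma card_neighbors_le_max_degree:
  assumes "pair_graph G"
  shows "card {v. (w, v) \<in> parcs G} \<le> max_degree G"
proof (cases "w \<in> pverts G")
  case True
  interpret pair_graph G
    by (rule assms)
  have "out_arcs (with_proj G) w = Pair w ` {v. (w, v) \<in> parcs G}"
    by (force simp: out_arcs_def)
  then have "out_degree (with_proj G) w = card {v. (w, v) \<in> parcs G}"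
    unfolding out_degree_def by (simp add: card_image inj_on_def)
  then show ?thesis
    unfolding max_degree_def using True pair_finite_verts by (metis Max_ge finite_imageI imageI)
next
  case False
  interpret pair_graph G
    by (rule assms)
  have "{v. (w, v) \<in> parcs G} = {}"
    using False wellformed' by auto
  then show ?thesis
    by (simp only: card.empty)
qed

text \<open>A simplex with face \<open>\<tau>\<close> is \<open>\<tau>\<close> or
  \<open>\<sigma>\<close>, and both are removed; so no remaining simplex has a removed face.\<close>

lemma simplicial_complex_collapse:
  assumes K: "simplicial_complex K" and \<tau>: "\<tau> \<subseteq> \<sigma>"
    and free: "\<And>\<rho>. \<rho> \<in> K \<Longrightarrow> \<tau> \<subseteq> \<rho> \<Longrightarrow> \<rho> = \<tau> \<or> \<rho> = \<sigma>"
  shows "simplicial_complex (K - {\<sigma>, \<tau>})"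
  unfolding simplicial_complex_def
proof (intro conjI ballI allI impI)
  fix \<rho> \<rho>'
  assume *: "\<rho> \<in> K - {\<sigma>, \<tau>}" "\<rho>' \<subseteq> \<rho>" "\<rho>' \<noteq> {}"
  then have "\<not> \<tau> \<subseteq> \<rho>"
    using free by blast
  then have "\<rho>' \<noteq> \<tau>" "\<rho>' \<noteq> \<sigma>"
    using * \<tau> by blast+
  moreover have "\<rho>' \<in> K"
    using simplicial_complexD(3)[OF K, of \<rho> \<rho>'] * by blast
  ultimately show "\<rho>' \<in> K - {\<sigma>, \<tau>}"
    by simp
qed (use simplicial_complexD[OF K] in auto)

lemma simplicial_complex_neighborhood_complex:
  assumes "pair_graph G"
  shows "simplicial_complex (neighborhood_complex G)"
proof -
  interpret pair_graph G
    by (rule assms)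
  have sub: "neighborhood_complex G \<subseteq> Pow (pverts G)"
    by (auto simp: neighborhood_complex_def)
  show ?thesis
    unfolding simplicial_complex_def
  proof (intro conjI ballI allI impI)
    show "finite (neighborhood_complex G)"
      using sub pair_finite_verts by (rule_tac finite_subset) auto
    show "finite \<sigma>" if "\<sigma> \<in> neighborhood_complex G" for \<sigma>
      using that sub pair_finite_verts finite_subset by blast
    show "\<tau> \<in> neighborhood_complex G" if "\<sigma> \<in> neighborhood_complex G" "\<tau> \<subseteq> \<sigma>" for \<sigma> \<tau>
      using that unfolding neighborhood_complex_def by blast
  qed
qed

lemma card_simplex_neighborhood_complex:
  assumes G: "pair_graph G" and \<sigma>: "\<sigma> \<in> neighborhood_complex G"
  shows "card \<sigma> \<le> max_degree G"
proof -
  interpret pair_graph G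
    by (rule G)
  obtain w where "\<forall>v\<in>\<sigma>. (v, w) \<in> parcs G"
    using \<sigma> by (auto simp: neighborhood_complex_def)
  then have "\<sigma> \<subseteq> {v. (w, v) \<in> parcs G}"
    using pair_sym_arcs by (auto simp: symmetric_def dest: symD)
  moreover have "finite {v. (w, v) \<in> parcs G}"
    using pair_finite_verts wellformed' by (rule_tac finite_subset[of _ "pverts G"]) auto
  ultimately have "card \<sigma> \<le> card {v. (w, v) \<in> parcs G}"
    by (intro card_mono)
  then show ?thesis
    using card_neighbors_le_max_degree[OF G, of w] by simp
qed

theorem theorem2p1:
  fixes G :: "'a pair_pre_digraph"
  assumes "pair_graph G"
    and "Digraph_Component.connected (with_proj G)"
    and "max_degree G \<le> 3"
    and "\<not> digraph_iso (with_proj G) (with_proj K4_graph)"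
    and "\<not> digraph_iso (with_proj G) (with_proj T_graph)"
    and "C \<in> connected_components_of (geometric_realization (neighborhood_complex G))"
  shows "contractible_space (subtopology (geometric_realization (neighborhood_complex G)) C) \<or>
    (\<exists>n\<ge>1. subtopology (geometric_realization (neighborhood_complex G)) C
             homotopy_equivalent_space wedge_of_circles n)"
proof -
  let ?K = "neighborhood_complex G"
  have deg: "card {v. (w, v) \<in> parcs G} \<le> 3" for w
    using card_neighbors_le_max_degree[OF assms(1), of w] assms(3) by simp
  obtain L0 where L0: "L0 \<subseteq> ?K" "simplicial_complex L0" "polyhedron L0 = C"
    "connected_space (geometric_realization L0)"
    "subtopology (geometric_realization ?K) C = geometric_realization L0"
    using component_subcomplex[OF simplicial_complex_neighborhood_complex[OF assms(1)] assms(6)] by blast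
  \<comment> \<open>All parts of \<open>Q\<close> survive a collapse. Being inside the neighborhood
    complex keeps the degree bounds usable, and the other conditions are what the graph case and the
    transfer back to \<open>C\<close> require.\<close>
  define Q where "Q = (\<lambda>L. L \<subseteq> ?K \<and> simplicial_complex L \<and> connected_space (geometric_realization L) \<and>
    geometric_realization L0 homotopy_equivalent_space geometric_realization L)"
  have "Q L0"
    using L0 by (simp add: Q_def homotopy_equivalent_space_refl)
  then obtain L where "Q L" and min: "\<And>M. Q M \<Longrightarrow> card L \<le> card M"
    using ex_has_least_nat[of Q L0 card] by blast
  then have L: "L \<subseteq> ?K" "simplicial_complex L" "connected_space (geometric_realization L)"
    "geometric_realization L0 homotopy_equivalent_space geometric_realization L"
    by (simp_all add: Q_def)
  have no_free: "\<exists>\<rho>\<in>L. \<sigma> - {v} \<subseteq> \<rho> \<and> \<rho> \<noteq> \<sigma> \<and> \<rho> \<noteq> \<sigma> - {v}"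
    if \<sigma>: "\<sigma> \<in> L" "card \<sigma> = 3" "v \<in> \<sigma>" for \<sigma> v
  proof (rule ccontr)
    assume "\<not> ?thesis"
    then have free: "\<rho> = \<sigma> - {v} \<or> \<rho> = \<sigma>" if "\<rho> \<in> L" "\<sigma> - {v} \<subseteq> \<rho>" for \<rho>
      using that by blast
    have "card (\<sigma> - {v}) = 2"
      using \<sigma> by simp
    then have ne: "\<sigma> - {v} \<noteq> {}"
      by fastforce
    let ?M = "L - {\<sigma>, \<sigma> - {v}}"
    obtain r where r: "homotopic_with (\<lambda>_. True) (geometric_realization L) (geometric_realization L) (id \<circ> r) id"
      "retraction_maps (geometric_realization L) (geometric_realization ?M) r id"
      by (rule elementary_collapse[OF L(2) \<sigma>(1,3) refl ne free])
    have "geometric_realization L0 homotopy_equivalent_space geometric_realization ?M"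
      using L(4) deformation_retraction_imp_homotopy_equivalent_space[OF r] homotopy_eqv_trans
      by blast
    moreover have "connected_space (geometric_realization ?M)"
      using connected_space_retraction_map_image L(3) r(2) unfolding retraction_map_def by blast
    moreover have "simplicial_complex ?M"
      using L(2) free by (intro simplicial_complex_collapse) auto
    ultimately have "card L \<le> card ?M"
      using L(1) by (intro min) (auto simp: Q_def)
    moreover have "card ?M < card L"
      using \<sigma>(1) simplicial_complexD(1)[OF L(2)] by (intro psubset_card_mono) auto
    ultimately show False
      by simp
  qed
  have "card \<sigma> \<noteq> 3" if "\<sigma> \<in> L" for \<sigma>
    using K4_or_T_if_no_free_face[OF assms(1,2) deg L(1) no_free that] assms(4,5) by blast
  moreover have "card \<sigma> \<le> 3" if "\<sigma> \<in> L" for \<sigma>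
    using card_simplex_neighborhood_complex[OF assms(1)] assms(3) L(1) that by (meson le_trans subsetD)
  ultimately have card: "card \<sigma> \<le> 2" if "\<sigma> \<in> L" for \<sigma>
    using that by (metis le_neq_implies_less less_Suc_eq_le numeral_2_eq_2 numeral_3_eq_3)
  \<comment> \<open>The graph case needs a point in \<open>L\<close>; the homotopy equivalence maps
    the nonempty \<open>C\<close> into its realization.\<close>
  have "C \<noteq> {}"
    using nonempty_connected_components_of[OF assms(6)] .
  then have "polyhedron L \<noteq> {}"
    using L(4) L0(3) unfolding homotopy_equivalent_space_def continuous_map_def by auto
  then have "contractible_space (geometric_realization L) \<or>
      (\<exists>n\<ge>1. geometric_realization L homotopy_equivalent_space wedge_of_circles n)"
    using connected_graph_contractible_or_wedge[OF L(2) card L(3)] by blast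
  then show ?thesis
    unfolding L0(5)
    using homotopy_equivalent_space_contractibility[OF L(4)] homotopy_eqv_trans[OF L(4)]
    by blast
qed

end
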